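(* Let $F\subset\mathbb G^d$ be the set $F=\bigcap_{s=1}^\infty F_s$ defined in the context, and let $\tau=\tau_F$ be the quasimeasure associated with $F$. Then $F$ is an $M$-set for the $d$-dimensional Walsh system with respect to convergence by rectangles, with respect to convergence by cubes, and with respect to repeated (iterated) convergence for every order of iterated summation. Moreover, the $d$-fold Walsh series $\sum_{\mathbf n\in\mathbb N_0^d}\widehat\tau_{\mathbf n}W_{\mathbf n}(\mathbf g)$ generating $\tau$ is a null-series realizing the $M$-set $F$ (for each of these types of convergence).
   Context: Fix an integer $d\ge 2$. $\mathbb G$ is the dyadic group: the set of sequences $g=(g_k)_{k\ge0}$, $g_k\in\{0,1\}$, with coordinatewise addition mod 2 (denoted $\oplus$) and the product topology; $\mathbb G^d$ is its $d$-th power with coordinatewise $\oplus$, and $\mu$ is the normalized Haar measure on $\mathbb G^d$. For $n\in\mathbb N_0$ write $n=\sum_k n_k2^k$, $n_k\in\{0,1\}$. For $k\in\mathbb N_0$ and $0\le m<2^k$ the dyadic interval of rank $k$ is $\Delta^{(k)}_m=\{g\in\mathbb G: g_t=m_{k-1-t},\ 0\le t<k\}$; for $\mathbf m=(m^1,\dots,m^d)\in\{0,\dots,2^k-1\}^d$ the dyadic cube of rank $k$ is $\Delta^{(k)}_{\mathbf m}=\Delta^{(k)}_{m^1}\times\dots\times\Delta^{(k)}_{m^d}$. Vectors are compared coordinatewise ($\mathbf a<\mathbf b$ iff $a^j<b^j$ for all $j$), $\mathbf 1=(1,\dots,1)$. Walsh functions: $W_n(g)=\prod_{k\ge0}(-1)^{g_kn_k}$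 and $W_{\mathbf n}(\mathbf g)=\prod_{l=1}^dW_{n^l}(g^l)$ for $\mathbf n\in\mathbb N_0^d$. For $\mathbf n,\mathbf m<2^k\mathbf 1$, $W_{\mathbf n}$ is constant on $\Delta^{(k)}_{\mathbf m}$; denote this value $W^{(k)}_{\mathbf n\mathbf m}$. Put $R_{k\mathbf 1}:=W_{2^k\mathbf 1}$. A $d$-fold Walsh series is $\sum_{\mathbf n\in\mathbb N_0^d}a_{\mathbf n}W_{\mathbf n}(\mathbf g)$, $a_{\mathbf n}\in\mathbb C$, with partial sums $S_{\mathbf N}(\mathbf g)=\sum_{\mathbf n<\mathbf N}a_{\mathbf n}W_{\mathbf n}(\mathbf g)$, $\mathbf N\in\mathbb N^d$. It converges by rectangles at $\mathbf g$ to $S$ if $S_{\mathbf N}(\mathbf g)\to S$ as $\min_jN^j\to\infty$; by cubes if $S_{N\mathbf 1}(\mathbf g)\to S$ as $N\to\infty$; repeatedly for a permutation $(j_1,\dots,j_d)$ of $(1,\dots,d)$ if $\sum_{n^{j_1}\in\mathbb N_0}\big(\sum_{n^{j_2}\in\mathbb N_0}\big(\cdots\big(\sum_{n^{j_d}\in\mathbb N_0}a_{\mathbf n}W_{\mathbf n}(\mathbf g)\big)\cdots\big)\big)=S$, each series converging. A set $A\subset\mathbb G^d$ is an $M$-set (for a given convergence type) if some series with not all coefficients zero converges to $0$ at every point of $\mathbb G^d\setminus A$; such a series is a null-series realizing $A$. A quasimeasure is a function $\tau$ on dyadic cubes with $\tau(\Delta^{(k)}_{\mathbf m})=\sum_{\boldsymbol\sigma\in\{0,1\}^d}\tau(\Delta^{(k+1)}_{2\mathbf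 m+\boldsymbol\sigma})$ for all $k,\mathbf m$. Its Fourier–Walsh coefficients are $\widehat\tau_{\mathbf n}=\sum_{\mathbf m<2^k\mathbf 1}W^{(k)}_{\mathbf n\mathbf m}\tau(\Delta^{(k)}_{\mathbf m})$ for any $k$ with $\mathbf n<2^k\mathbf 1$; the series $\sum\widehat\tau_{\mathbf n}W_{\mathbf n}$ is the series generating $\tau$ (equivalently, $\tau(\Delta^{(k)})=2^{-kd}S_{2^k\mathbf 1}(\mathbf g)$ for $\mathbf g\in\Delta^{(k)}$). For a nonempty closed $F\subset\mathbb G^d$, $\tau_F$ is the unique nonnegative quasimeasure with $\tau_F(\mathbb G^d)=1$, $\tau_F(\Delta)=0$ iff $\Delta\cap F=\emptyset$, and such that if $\Delta^{(k)}_{\mathbf m}\cap F\neq\emptyset$ and exactly $M$ of the $2^d$ cubes $\Delta^{(k+1)}_{2\mathbf m+\boldsymbol\sigma}$ meet $F$, then each of those has $\tau_F$-value $\tau_F(\Delta^{(k)}_{\mathbf m})/M$ (the others have value $0$). The set $F$: let $m_1=0$, $m_{s+1}=2(2m_s+1)$. For $s\in\mathbb N$ put $F_s=\bigcup_{\mathbf m<2^{m_s}\mathbf 1}\bigcup_{\mathbf m'<2^{m_s}\mathbf 1}\{\mathbf g\in\Delta^{(2m_s)}_{2^{m_s}\mathbf m+\mathbf m'}: R_{2m_s\mathbf 1}(\mathbf g)=W^{(m_s)}_{\mathbf m\mathbf m'}\}$, and $F=\bigcap_{s\ge1}F_s$. *)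

theory Defs
  imports Complex_Main "HOL-Library.Cardinality"
begin

text \<open>Dimension d = CARD('n) (index type 'n :: finite).
  A point of G^d is g :: 'n \<Rightarrow> nat \<Rightarrow> bool (g j k = True means g^j_k = 1);
  a multi-index in N_0^d is n :: 'n \<Rightarrow> nat.\<close>

type_synonym 'n pt = "'n \<Rightarrow> nat \<Rightarrow> bool"
type_synonym 'n idx = "'n \<Rightarrow> nat"

definition walsh1 :: "nat \<Rightarrow> (nat \<Rightarrow> bool) \<Rightarrow> real" where
  "walsh1 n g = (\<Prod>k\<in>{k. bit n k}. if g k then -1 else 1)"

definition walsh :: "('n::finite) idx \<Rightarrow> 'n pt \<Rightarrow> real" where
  "walsh n g = (\<Prod>j\<in>UNIV. walsh1 (n j) (g j))"

definition dyad_int :: "nat \<Rightarrow> nat \<Rightarrow> (nat \<Rightarrow> bool) set" where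
  "dyad_int k m = {g. \<forall>t<k. g t = bit m (k - 1 - t)}"

definition dyad_cube :: "nat \<Rightarrow> ('n::finite) idx \<Rightarrow> 'n pt set" where
  "dyad_cube k m = {g. \<forall>j. g j \<in> dyad_int k (m j)}"

definition idx_below :: "nat \<Rightarrow> ('n::finite) idx set" where
  "idx_below N = {m. \<forall>j. m j < N}"

text \<open>W^{(k)}_{n m}: the (constant) value of W_n on the cube of rank k with index m,
  evaluated at a point of that cube.\<close>
definition cube_pt :: "nat \<Rightarrow> ('n::finite) idx \<Rightarrow> 'n pt" where
  "cube_pt k m = (\<lambda>j t. t < k \<and> bit (m j) (k - 1 - t))"

definition walshk :: "nat \<Rightarrow> ('n::finite) idx \<Rightarrow> 'n idx \<Rightarrow> real" where
  "walshk k n m = walsh n (cube_pt k m)"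

text \<open>Quasimeasures are represented as functions of (rank, index vector) of a dyadic cube.\<close>

text \<open>Fourier--Walsh coefficient, computed at the rank K = max_j n_j (so n < 2^K 1).\<close>
definition tau_coef :: "(nat \<Rightarrow> ('n::finite) idx \<Rightarrow> real) \<Rightarrow> 'n idx \<Rightarrow> real" where
  "tau_coef \<tau> n = (let K = Max (range n) in
      \<Sum>m\<in>idx_below (2^K). walshk K n m * \<tau> K m)"

definition tau_series :: "(nat \<Rightarrow> ('n::finite) idx \<Rightarrow> real) \<Rightarrow> 'n idx \<Rightarrow> complex" where
  "tau_series \<tau> n = complex_of_real (tau_coef \<tau> n)"

fun tauF :: "('n::finite) pt set \<Rightarrow> nat \<Rightarrow> 'n idx \<Rightarrow> real" where
  "tauF F 0 m = (if dyad_cube 0 m \<inter> F \<noteq> {} then 1 else 0)"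
| "tauF F (Suc k) m =
     (let p = (\<lambda>j. m j div 2);
          M = card {\<sigma>::'n \<Rightarrow> bool. dyad_cube (Suc k) (\<lambda>j. 2 * p j + (if \<sigma> j then 1 else 0)) \<inter> F \<noteq> {}}
      in if dyad_cube (Suc k) m \<inter> F \<noteq> {} then tauF F k p / real M else 0)"

definition psum :: "(('n::finite) idx \<Rightarrow> complex) \<Rightarrow> 'n idx \<Rightarrow> 'n pt \<Rightarrow> complex" where
  "psum a N g = (\<Sum>n\<in>{n. \<forall>j. n j < N j}. a n * complex_of_real (walsh n g))"

definition conv_rect :: "(('n::finite) idx \<Rightarrow> complex) \<Rightarrow> 'n pt \<Rightarrow> complex \<Rightarrow> bool" where
  "conv_rect a g S \<longleftrightarrow>
     (\<forall>\<epsilon>>0. \<exists>M. \<forall>N. (\<forall>j. M \<le> N j) \<longrightarrow> norm (psum a N g - S) < \<epsilon>)"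

definition conv_cube :: "(('n::finite) idx \<Rightarrow> complex) \<Rightarrow> 'n pt \<Rightarrow> complex \<Rightarrow> bool" where
  "conv_cube a g S \<longleftrightarrow> (\<lambda>N. psum a (\<lambda>_. N) g) \<longlonglongrightarrow> S"

fun rsum :: "(('n::finite) idx \<Rightarrow> complex) \<Rightarrow> 'n list \<Rightarrow> 'n idx \<Rightarrow> complex" where
  "rsum f [] n = f n"
| "rsum f (j # js) n = (\<Sum>k. rsum f js (n(j := k)))"

fun rconv :: "(('n::finite) idx \<Rightarrow> complex) \<Rightarrow> 'n list \<Rightarrow> 'n idx \<Rightarrow> bool" where
  "rconv f [] n = True"
| "rconv f (j # js) n =
     (summable (\<lambda>k. rsum f js (n(j := k))) \<and> (\<forall>k. rconv f js (n(j := k))))"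

definition conv_rep :: "('n::finite) list \<Rightarrow> ('n idx \<Rightarrow> complex) \<Rightarrow> 'n pt \<Rightarrow> complex \<Rightarrow> bool" where
  "conv_rep js a g S \<longleftrightarrow>
     (let f = (\<lambda>n. a n * complex_of_real (walsh n g)) in
        rconv f js (\<lambda>_. 0) \<and> rsum f js (\<lambda>_. 0) = S)"

definition null_series_for ::
  "((('n::finite) idx \<Rightarrow> complex) \<Rightarrow> 'n pt \<Rightarrow> complex \<Rightarrow> bool) \<Rightarrow> ('n idx \<Rightarrow> complex) \<Rightarrow> 'n pt set \<Rightarrow> bool" where
  "null_series_for conv a A \<longleftrightarrow> (\<exists>n. a n \<noteq> 0) \<and> (\<forall>g. g \<notin> A \<longrightarrow> conv a g 0)"

definition is_M_set ::
  "((('n::finite) idx \<Rightarrow> complex) \<Rightarrow> 'n pt \<Rightarrow> complex \<Rightarrow> bool) \<Rightarrow> 'n pt set \<Rightarrow> bool" where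
  "is_M_set conv A \<longleftrightarrow> (\<exists>a. null_series_for conv a A)"

text \<open>The set F. mseq s = m_{s+1}: m_1 = 0, m_{s+1} = 2(2 m_s + 1).\<close>
primrec mseq :: "nat \<Rightarrow> nat" where
  "mseq 0 = 0"
| "mseq (Suc s) = 2 * (2 * mseq s + 1)"

text \<open>F_s for q = m_s; R_{k 1} = W_{2^k 1}.\<close>
definition Fpart :: "nat \<Rightarrow> ('n::finite) pt set" where
  "Fpart q = (\<Union>m\<in>idx_below (2^q). \<Union>m'\<in>idx_below (2^q).
      {g \<in> dyad_cube (2*q) (\<lambda>j. 2^q * m j + m' j).
         walsh (\<lambda>_. 2^(2*q)) g = walshk q m m'})"

definition Fset :: "('n::finite) pt set" where
  "Fset = (\<Inter>s. Fpart (mseq s))"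

end

theory Submission
  imports Defs "HOL-Library.FuncSet"
begin

text \<open>
  Write \<open>q = m\<^sub>s\<close>, and let \<open>x\<close> and \<open>y\<close> be the first and the second \<open>q\<close> digits of \<open>g\<close>.
  The set \<open>F\<^sub>s\<close> is given by the equation \<open>R\<^sub>s = B\<^sub>s\<close>, where \<open>R\<^sub>s\<close> is a Rademacher
  function of rank \<open>2 q\<close> and \<open>B\<^sub>s = (-1)\<close> to the power \<open>x \<sqdot> rev y\<close>. Hence the density of \<open>\<tau>\<close> at rank
  \<open>k\<close> is the Riesz product of the factors \<open>1 + R\<^sub>s B\<^sub>s\<close> with \<open>2 m\<^sub>s < k\<close>, and it vanishes at a
  point outside \<open>F\<close> for all large \<open>k\<close>.

  Let \<open>P\<^sub>s\<close> be the product of the first \<open>s\<close> factors; it depends on the first \<open>q / 2\<close> digits only.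
  The Fourier coefficients of \<open>R\<^sub>s B\<^sub>s P\<^sub>s\<close> live in the cube of indices with all entries in
  \<open>[2\<^bsup>2q\<^esup>, 2\<^bsup>2q+1\<^esup>)\<close>, where the one at \<open>2\<^bsup>2q\<^esup> + 2\<^bsup>q\<^esup> v + u\<close> is \<open>2\<^bsup>-qd\<^esup> W\<^sub>u(v') P\<^sub>s(v')\<close>, with
  \<open>v'\<close> the point of the cube of rank \<open>q\<close> and index \<open>v\<close>. A rectangular partial sum cuts at most one of
  these cubes, so it equals some \<open>P\<^sub>s(g)\<close> plus an incomplete sum over one cube. Summing over \<open>u\<close>
  first turns the latter into a sum over \<open>v\<close> of \<open>P\<^sub>s(v')\<close> times normalized Dirichlet kernels at
  \<open>v' - x\<close>, with at most \<open>2\<^bsup>d\<^esup>\<close> nonzero terms. If \<open>P\<^sub>s(g) = 0\<close> and \<open>P\<^sub>s(v') \<noteq> 0\<close>, then \<open>v'\<close> and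
  \<open>x\<close> differ within the first \<open>q / 2\<close> digits, so one of the kernels is at most \<open>2\<^bsup>-q/2\<^esup>\<close>, while
  \<open>P\<^sub>s \<le> 2\<^bsup>s\<^esup>\<close>. This proves rectangular convergence. In an iterated sum the inner sums are
  finite, and the partial sums of the outermost one are rectangular partial sums.
\<close>

section \<open>Walsh functions in one variable\<close>

definition sg :: "bool \<Rightarrow> real" where
  "sg b = (if b then -1 else 1)"

lemma sg_simps [simp]: "sg True = -1" "sg False = 1" "sg b * sg b = 1" "\<bar>sg b\<bar> = 1" "sg b \<noteq> 0"
  by (auto simp: sg_def)

lemma sum_lessThan_add:
  fixes f :: "nat \<Rightarrow> 'a::comm_monoid_add"
  shows "(\<Sum>i<m + n. f i) = (\<Sum>i<m. f i) + (\<Sum>i<n. f (m + i))"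
  by (induction n) (auto simp: ac_simps)

lemma prod_lessThan_add:
  fixes f :: "nat \<Rightarrow> 'a::comm_monoid_mult"
  shows "(\<Prod>i<m + n. f i) = (\<Prod>i<m. f i) * (\<Prod>i<n. f (m + i))"
  by (induction n) (auto simp: ac_simps)

lemma nat_bit_less:
  fixes n :: nat
  assumes "n < 2 ^ p" "bit n k"
  shows "k < p"
proof (rule ccontr)
  assume "\<not> k < p"
  then have "(2::nat) ^ p \<le> 2 ^ k" by (intro power_increasing) auto
  with assms(1) have "n < 2 ^ k" by (rule less_le_trans)
  then show False using assms(2) by (simp add: bit_iff_odd)
qed

lemma bit_mult_add_iff:
  fixes u w :: nat
  assumes "u < 2 ^ p"
  shows "bit (2 ^ p * w + u) k \<longleftrightarrow> (if k < p then bit u k else bit w (k - p))"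
proof (cases "k < p")
  case True
  have "bit (2 ^ p * w + u) k \<longleftrightarrow> bit (take_bit p (2 ^ p * w + u)) k"
    using True by (simp add: bit_take_bit_iff)
  also have "take_bit p (2 ^ p * w + u) = u"
    using assms by (simp add: take_bit_eq_mod)
  finally show ?thesis using True by simp
next
  case False
  have "bit (2 ^ p * w + u) k \<longleftrightarrow> bit (drop_bit p (2 ^ p * w + u)) (k - p)"
    using False by (simp add: bit_drop_bit_eq)
  also have "drop_bit p (2 ^ p * w + u) = w"
    using assms by (simp add: drop_bit_eq_div)
  finally show ?thesis using False by simp
qed

lemma walsh1_eq:
  assumes "n < 2 ^ p"
  shows "walsh1 n g = (\<Prod>k<p. sg (bit n k \<and> g k))"
proof -
  have "(\<Prod>k<p. sg (bit n k \<and> g k)) = (\<Prod>k\<in>{k. bit n k}. sg (bit n k \<and> g k))"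
    by (rule prod.mono_neutral_right) (use nat_bit_less[OF assms] in auto)
  also have "\<dots> = walsh1 n g"
    unfolding walsh1_def by (rule prod.cong) (auto simp: sg_def)
  finally show ?thesis by simp
qed

lemma walsh1_0 [simp]: "walsh1 0 g = 1"
  by (simp add: walsh1_def)

lemma walsh1_1 [simp]: "walsh1 (Suc 0) g = sg (g 0)"
  by (subst walsh1_eq[of _ 1]) (auto simp: bit_0)

lemma abs_walsh1 [simp]: "\<bar>walsh1 n g\<bar> = 1"
  by (subst walsh1_eq[of _ n]) (auto simp: abs_prod)

lemma walsh1_mult: "walsh1 n g * walsh1 n h = walsh1 n (\<lambda>t. g t \<noteq> h t)"
proof -
  have n: "n < 2 ^ n" by simp
  show ?thesis
    unfolding walsh1_eq[OF n] prod.distrib[symmetric]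
    by (rule prod.cong) (auto simp: sg_def)
qed

text \<open>The binary digits of \<open>2 ^ p * w + u\<close> are those of \<open>u\<close> followed
  by those of \<open>w\<close>, so \<open>w\<close> acts on the shift of \<open>g\<close> by
  \<open>p\<close>.\<close>

lemma walsh1_split:
  assumes "u < 2 ^ p"
  shows "walsh1 (2 ^ p * w + u) g = walsh1 u g * walsh1 w (\<lambda>t. g (t + p))"
proof -
  have w: "w < 2 ^ w" by simp
  have "2 ^ p * w + u < 2 ^ p * (w + 1)" using assms by simp
  also have "\<dots> \<le> 2 ^ p * 2 ^ w" using w by (intro mult_left_mono) (auto simp: Suc_le_eq simp del: less_exp)
  finally have lt: "2 ^ p * w + u < 2 ^ (p + w)" by (simp add: power_add)
  have "walsh1 (2 ^ p * w + u) g = (\<Prod>k<p+w. sg (bit (2 ^ p * w + u) k \<and> g k))"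
    by (rule walsh1_eq[OF lt])
  also have "\<dots> = (\<Prod>k<p. sg (bit u k \<and> g k)) * (\<Prod>k<w. sg (bit w k \<and> g (k + p)))"
    unfolding prod_lessThan_add by (simp add: bit_mult_add_iff[OF assms] add.commute[of p])
  finally show ?thesis by (simp add: walsh1_eq[OF assms] walsh1_eq[OF w])
qed

text \<open>This is the Dirichlet kernel of order \<open>2 ^ k\<close>: each new digit multiplies
  the sum by \<open>1 + sg (z k)\<close>.\<close>

lemma sum_walsh1_pow2:
  "(\<Sum>u<2 ^ k. walsh1 u z) = (if \<forall>t<k. \<not> z t then 2 ^ k else 0)"
proof (induction k)
  case 0
  then show ?case by simp
next
  case (Suc k)
  have "(\<Sum>u<2 ^ Suc k. walsh1 u z) = (\<Sum>u<2 ^ k. walsh1 u z) + (\<Sum>u<2 ^ k. walsh1 (2 ^ k + u) z)"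
    by (simp add: mult_2 sum_lessThan_add)
  also have "(\<Sum>u<2 ^ k. walsh1 (2 ^ k + u) z) = (\<Sum>u<2 ^ k. walsh1 u z * sg (z k))"
    by (rule sum.cong) (use walsh1_split[of _ k 1 z] in auto)
  finally show ?case
    by (auto simp: Suc.IH sum_distrib_right[symmetric] less_Suc_eq)
qed

text \<open>Aligned blocks of length \<open>2 ^ p\<close> sum to zero, so only the last incomplete block contributes.\<close>
lemma abs_sum_walsh1_le:
  assumes "z t" "t < p"
  shows "\<bar>\<Sum>u<c. walsh1 u z\<bar> \<le> 2 ^ p"
proof -
  have zero: "(\<Sum>u<2 ^ p * w. walsh1 u z) = 0" for w
  proof (induction w)
    case (Suc w)
    have "(\<Sum>u<2 ^ p * Suc w. walsh1 u z) = (\<Sum>u<2 ^ p * w + 2 ^ p. walsh1 u z)"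
      by (simp add: add.commute)
    also have "\<dots> = (\<Sum>u<2 ^ p. walsh1 (2 ^ p * w + u) z)"
      by (simp add: sum_lessThan_add Suc)
    also have "\<dots> = (\<Sum>u<2 ^ p. walsh1 u z * walsh1 w (\<lambda>t. z (t + p)))"
      by (rule sum.cong) (use walsh1_split[of _ p w z] in auto)
    also have "\<dots> = 0"
      using assms by (auto simp: sum_distrib_right[symmetric] sum_walsh1_pow2)
    finally show ?case .
  qed simp
  define w r where "w = c div 2 ^ p" and "r = c mod 2 ^ p"
  have c: "c = 2 ^ p * w + r" by (simp add: w_def r_def)
  have r: "r \<le> 2 ^ p" by (simp add: r_def less_imp_le)
  have "\<bar>\<Sum>u<c. walsh1 u z\<bar> = \<bar>\<Sum>u<r. walsh1 (2 ^ p * w + u) z\<bar>"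
    unfolding c by (simp add: sum_lessThan_add zero)
  also have "\<dots> \<le> (\<Sum>u<r. \<bar>walsh1 (2 ^ p * w + u) z\<bar>)" by (rule sum_abs)
  also have "\<dots> = real r" by simp
  also have "\<dots> \<le> 2 ^ p" using r by (metis of_nat_le_iff of_nat_numeral of_nat_power)
  finally show ?thesis .
qed

section \<open>Digit reversal between points and indices of dyadic intervals\<close>

definition int_pt :: "nat \<Rightarrow> nat \<Rightarrow> nat \<Rightarrow> bool" where
  "int_pt k m = (\<lambda>t. t < k \<and> bit m (k - 1 - t))"

definition int_idx :: "nat \<Rightarrow> (nat \<Rightarrow> bool) \<Rightarrow> nat" where
  "int_idx k g = horner_sum of_bool 2 (map (\<lambda>t. g (k - 1 - t)) [0..<k])"

lemma bit_int_idx: "bit (int_idx k g) i \<longleftrightarrow> i < k \<and> g (k - 1 - i)"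
  by (auto simp: int_idx_def bit_horner_sum_bit_iff)

lemma int_idx_less: "int_idx k g < 2 ^ k"
  unfolding int_idx_def by (metis horner_sum_of_bool_2_less length_map length_upt minus_nat.diff_0)

lemma int_pt_int_idx: "t < k \<Longrightarrow> int_pt k (int_idx k g) t = g t"
  by (auto simp: int_pt_def bit_int_idx)

lemma int_idx_unique:
  assumes "m < 2 ^ k" "\<And>t. t < k \<Longrightarrow> int_pt k m t = g t"
  shows "m = int_idx k g"
proof (rule bit_eqI)
  fix i
  show "bit m i = bit (int_idx k g) i"
  proof (cases "i < k")
    case True
    then show ?thesis using assms(2)[of "k - 1 - i"] by (auto simp: bit_int_idx int_pt_def)
  next
    case False
    then show ?thesis using nat_bit_less[OF assms(1), of i] by (auto simp: bit_int_idx)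
  qed
qed

lemma int_pt_inj:
  assumes "m < 2 ^ k" "n < 2 ^ k" "\<And>t. t < k \<Longrightarrow> int_pt k m t = int_pt k n t"
  shows "m = n"
  using int_idx_unique[of m k "int_pt k n"] int_idx_unique[of n k "int_pt k n"] assms by auto

text \<open>Both sides pair digit \<open>i\<close> of one number with digit \<open>k - 1 - i\<close>
  of the other; reflecting \<open>i\<close> exchanges the roles.\<close>

lemma walsh1_int_pt_sym:
  assumes "m < 2 ^ k" "n < 2 ^ k"
  shows "walsh1 n (int_pt k m) = walsh1 m (int_pt k n)"
proof -
  have "(\<Prod>i<k. sg (bit n i \<and> int_pt k m i)) = (\<Prod>i<k. sg (bit m i \<and> int_pt k n i))"
    by (rule prod.reindex_bij_witness[of _ "\<lambda>i. k - 1 - i" "\<lambda>i. k - 1 - i"])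
       (auto simp: int_pt_def conj_commute)
  then show ?thesis using assms by (simp add: walsh1_eq)
qed

text \<open>One coordinate's share of a block, cut at \<open>N\<close>, for fixed middle digits
  \<open>v\<close>: apart from signs, a Dirichlet kernel normalized by \<open>2 ^ q\<close>.
  Truncated subtraction makes the sum empty when \<open>N\<close> stops before these
  indices.\<close>

definition block_inner :: "nat \<Rightarrow> nat \<Rightarrow> nat \<Rightarrow> (nat \<Rightarrow> bool) \<Rightarrow> real" where
  "block_inner q N v h = sg (h (2 * q)) * walsh1 v (\<lambda>t. h (t + q))
     * (\<Sum>u<min (2 ^ q) (N - (2 ^ (2 * q) + 2 ^ q * v)). walsh1 u (\<lambda>t. int_pt q v t \<noteq> h t)) / 2 ^ q"

text \<open>Each such \<open>n\<close> is \<open>2 ^ (2 * q) + 2 ^ q * v + u\<close> for a unique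
  \<open>u < 2 ^ q\<close>. Its Walsh function splits into a Rademacher factor, a factor for
  \<open>v\<close> and one for \<open>u\<close>, and the last merges with the coefficient.\<close>

lemma sum_block_inner:
  assumes v: "v < 2 ^ q"
  shows "(\<Sum>n | 2 ^ (2 * q) \<le> n \<and> n < 2 ^ (2 * q + 1) \<and> n < N \<and> n div 2 ^ q mod 2 ^ q = v.
            walsh1 (n mod 2 ^ q) (int_pt q v) / 2 ^ q * walsh1 n h) = block_inner q N v h"
    (is "sum ?f ?A = _")
proof -
  define a :: nat where "a = 2 ^ q"
  have a: "a > 0" "2 ^ (2 * q) = a * a" "2 ^ (2 * q + 1) = 2 * (a * a)" "2 ^ q = a"
    by (auto simp: a_def power_add mult_2)
  define c where "c = min (2 ^ q) (N - (2 ^ (2 * q) + 2 ^ q * v))"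
  have va: "a * v + a \<le> a * a"
    using v unfolding a by (metis Suc_leI add.commute mult_Suc_right mult_le_mono2)
  have "sum ?f ?A = (\<Sum>u<c. ?f (2 ^ (2 * q) + 2 ^ q * v + u))"
  proof (rule sum.reindex_bij_witness[of _ "\<lambda>u. 2 ^ (2 * q) + 2 ^ q * v + u" "\<lambda>n. n - (2 ^ (2 * q) + 2 ^ q * v)"])
    fix n assume "n \<in> ?A"
    then have n: "a * a \<le> n" "n < 2 * (a * a)" "n < N" "n div a mod a = v"
      unfolding a by auto
    \<comment> \<open>The quotient lies in \<open>[a, 2 * a)\<close>, so reduction modulo
      \<open>a\<close> subtracts \<open>a\<close> exactly once.\<close>
    have "n div a < 2 * a" using n a(1) by (simp add: less_mult_imp_div_less mult.assoc)
    moreover have "a \<le> n div a" using n a(1) by (simp add: less_eq_div_iff_mult_less_eq)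
    ultimately have "n div a mod a = n div a - a"
      by (metis add.commute le_add_diff_inverse2 less_diff_conv2 mod_add_self2 mod_less mult_2)
    with n(4) \<open>a \<le> n div a\<close> have "n div a = a + v" by auto
    then have "n = a * (a + v) + n mod a" by (metis mult_div_mod_eq)
    then have n': "n = a * a + a * v + n mod a" by (simp add: algebra_simps)
    have m: "n mod a < a" using a(1) by simp
    show "2 ^ (2 * q) + 2 ^ q * v + (n - (2 ^ (2 * q) + 2 ^ q * v)) = n"
      unfolding a using n' by linarith
    show "n - (2 ^ (2 * q) + 2 ^ q * v) \<in> {..<c}"
      unfolding a c_def using n' n(3) m by auto
    show "?f (2 ^ (2 * q) + 2 ^ q * v + (n - (2 ^ (2 * q) + 2 ^ q * v))) = ?f n"
      unfolding a using n' by simp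
  next
    fix u assume "u \<in> {..<c}"
    then have u: "u < a" "a * a + a * v + u < N" unfolding c_def a by auto
    have e: "a * a + a * v + u = a * (a + v) + u" by (simp add: algebra_simps)
    have "(a * a + a * v + u) div a = a + v" unfolding e using u(1) by simp
    then have "(a * a + a * v + u) div a mod a = v" using v a by simp
    then show "2 ^ (2 * q) + 2 ^ q * v + u \<in> ?A" unfolding a using u va by auto
    show "2 ^ (2 * q) + 2 ^ q * v + u - (2 ^ (2 * q) + 2 ^ q * v) = u" by simp
  qed
  also have "\<dots> = (\<Sum>u<c. sg (h (2 * q)) * walsh1 v (\<lambda>t. h (t + q)) * walsh1 u (\<lambda>t. int_pt q v t \<noteq> h t) / 2 ^ q)"
  proof (rule sum.cong)
    fix u assume "u \<in> {..<c}"
    then have u: "u < 2 ^ q" by (auto simp: c_def)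
    have e: "2 ^ (2 * q) + 2 ^ q * v + u = 2 ^ q * (2 ^ q * 1 + v) + u"
      by (simp add: power_add mult_2 distrib_left)
    have "walsh1 (2 ^ (2 * q) + 2 ^ q * v + u) h = walsh1 u h * (walsh1 v (\<lambda>t. h (t + q)) * walsh1 1 (\<lambda>t. h (t + q + q)))"
      unfolding e walsh1_split[OF u] walsh1_split[OF v] by simp
    moreover have "(2 ^ (2 * q) + 2 ^ q * v + u) mod 2 ^ q = u"
      unfolding e using u by simp
    ultimately show "?f (2 ^ (2 * q) + 2 ^ q * v + u) =
        sg (h (2 * q)) * walsh1 v (\<lambda>t. h (t + q)) * walsh1 u (\<lambda>t. int_pt q v t \<noteq> h t) / 2 ^ q"
      by (simp add: walsh1_mult[of u "int_pt q v" h, simplified, symmetric] mult_2[symmetric])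
  qed simp
  also have "\<dots> = block_inner q N v h"
    by (simp add: block_inner_def c_def sum_distrib_left sum_divide_distrib)
  finally show ?thesis .
qed

text \<open>Once \<open>N\<close> lies beyond the block, the kernel is complete and hence an
  indicator function.\<close>

lemma block_inner_full:
  assumes v: "v < 2 ^ q" and N: "2 ^ (2 * q + 1) \<le> N"
  shows "block_inner q N v h = (if v = int_idx q h then sg (h (2 * q)) * walsh1 v (\<lambda>t. h (t + q)) else 0)"
proof -
  have "2 ^ q * (v + 1) \<le> 2 ^ q * (2 ^ q :: nat)" using v by (intro mult_left_mono) auto
  then have "2 ^ (2 * q) + 2 ^ q * v + 2 ^ q \<le> N"
    using N by (simp add: mult_2 power_add)
  then have m: "min (2 ^ q) (N - (2 ^ (2 * q) + 2 ^ q * v)) = 2 ^ q" by simp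
  have "v = int_idx q h \<longleftrightarrow> (\<forall>t<q. int_pt q v t = h t)"
    using int_idx_unique[OF v] int_pt_int_idx by metis
  then show ?thesis by (auto simp: block_inner_def m sum_walsh1_pow2)
qed

lemma abs_block_inner_le_1: "\<bar>block_inner q N v h\<bar> \<le> 1"
proof -
  define c where "c = min (2 ^ q) (N - (2 ^ (2 * q) + 2 ^ q * v))"
  have "\<bar>\<Sum>u<c. walsh1 u (\<lambda>t. int_pt q v t \<noteq> h t)\<bar> \<le> (\<Sum>u<c. \<bar>walsh1 u (\<lambda>t. int_pt q v t \<noteq> h t)\<bar>)"
    by (rule sum_abs)
  also have "\<dots> \<le> 2 ^ q"
    by (simp add: c_def min_def)
  finally show ?thesis by (simp add: block_inner_def c_def[symmetric] abs_mult)
qed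

lemma abs_block_inner_le:
  assumes "t < p" "int_pt q v t \<noteq> h t"
  shows "\<bar>block_inner q N v h\<bar> \<le> 2 ^ p / 2 ^ q"
  using abs_sum_walsh1_le[of "\<lambda>t. int_pt q v t \<noteq> h t" t p] assms
  by (simp add: block_inner_def abs_mult divide_right_mono)

text \<open>A complete kernel vanishes unless \<open>v\<close> is the index of \<open>h\<close>. A
  nonempty incomplete one means that \<open>N\<close> cuts the run of \<open>2 ^ q\<close> indices
  belonging to \<open>v\<close>, which determines \<open>v\<close>.\<close>

lemma block_inner_nonzero:
  assumes v: "v < 2 ^ q" and nz: "block_inner q N v h \<noteq> 0"
  shows "v = int_idx q h \<or> v = (N - 2 ^ (2 * q)) div 2 ^ q"
proof (rule ccontr)
  assume neg: "\<not> ?thesis"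
  define c where "c = min (2 ^ q) (N - (2 ^ (2 * q) + 2 ^ q * v))"
  obtain t where t: "t < q" "int_pt q v t \<noteq> h t"
    using int_idx_unique[OF v] neg by blast
  have "c \<noteq> 2 ^ q"
    using nz t by (auto simp: block_inner_def c_def[symmetric] sum_walsh1_pow2 split: if_splits)
  moreover have "c \<noteq> 0"
  proof
    assume "c = 0"
    then show False using nz unfolding block_inner_def c_def[symmetric] by simp
  qed
  ultimately have "2 ^ q * v \<le> N - 2 ^ (2 * q)" "N - 2 ^ (2 * q) < 2 ^ q * v + 2 ^ q"
    by (auto simp: c_def min_def split: if_splits)
  then have "(N - 2 ^ (2 * q)) div 2 ^ q = v"
    by (intro div_nat_eqI) (auto simp: algebra_simps)
  with neg show False by simp
qed

section \<open>The set F and its Riesz product\<close>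

lemma sum_box_prod:
  fixes f :: "'n::finite \<Rightarrow> 'b \<Rightarrow> 'c::comm_semiring_1"
  assumes "\<And>j. finite (B j)"
  shows "(\<Sum>n | \<forall>j. n j \<in> B j. \<Prod>j\<in>UNIV. f j (n j)) = (\<Prod>j\<in>UNIV. \<Sum>u\<in>B j. f j u)"
proof -
  have "{n. \<forall>j. n j \<in> B j} = PiE UNIV B" by auto
  then show ?thesis using prod_sum_PiE[of UNIV B f] assms by simp
qed

lemma finite_box: "finite {n :: 'n::finite idx. \<forall>j. n j < N j}"
proof -
  have "{n :: 'n idx. \<forall>j. n j < N j} = PiE UNIV (\<lambda>j. {..<N j})" by auto
  then show ?thesis by (simp add: finite_PiE)
qed

lemma finite_idx_below [simp]: "finite (idx_below N :: 'n::finite idx set)"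
  unfolding idx_below_def by (rule finite_box)

lemma cube_pt_eq: "cube_pt k m j = int_pt k (m j)"
  by (simp add: cube_pt_def int_pt_def)

lemma mem_dyad_cube_iff: "g \<in> dyad_cube k m \<longleftrightarrow> (\<forall>j. \<forall>t<k. g j t = cube_pt k m j t)"
  by (auto simp: dyad_cube_def dyad_int_def cube_pt_def)

section \<open>Growth of the ranks\<close>

lemma strict_mono_mseq: "strict_mono mseq"
  by (rule strict_mono_Suc_iff[THEN iffD2]) simp

lemma le_mseq: "s \<le> mseq s"
  by (simp add: strict_mono_imp_increasing strict_mono_mseq)

lemma mseq_eq_iff [simp]: "mseq s = mseq t \<longleftrightarrow> s = t"
  using strict_mono_eq[OF strict_mono_mseq] .

lemma mseq_less_iff [simp]: "mseq s < mseq t \<longleftrightarrow> s < t"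
  using strict_mono_less[OF strict_mono_mseq] .

text \<open>Consequently all digits read by factor \<open>s\<close> lie in the first half of the
  first digit group of factor \<open>t\<close>.\<close>

lemma mseq_gap:
  assumes "s < t"
  shows "2 * mseq s < mseq t div 2"
proof -
  have "mseq (Suc s) \<le> mseq t"
    using assms strict_mono_less_eq[OF strict_mono_mseq, of "Suc s" t] by (simp only: Suc_le_eq)
  then show ?thesis by simp
qed

text \<open>\<open>top_sign q\<close> is the Rademacher function of rank \<open>2 q\<close>; \<open>bent q\<close> is the quadratic
  character whose value on a cube of rank \<open>2 q\<close> is the number \<open>W\<close> in the definition of \<open>Fpart\<close>.\<close>

definition top_sign :: "nat \<Rightarrow> 'n::finite pt \<Rightarrow> real" where
  "top_sign q g = (\<Prod>j\<in>UNIV. sg (g j (2 * q)))"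

definition bent :: "nat \<Rightarrow> 'n::finite pt \<Rightarrow> real" where
  "bent q g = (\<Prod>j\<in>UNIV. \<Prod>i<q. sg (g j (q - 1 - i) \<and> g j (q + i)))"

lemma prod_sg_cases:
  "finite A \<Longrightarrow> (\<Prod>j\<in>A. sg (P j)) = 1 \<or> (\<Prod>j\<in>A. sg (P j)) = -1"
  by (induction A rule: finite_induct) (auto simp: sg_def)

lemma top_sign_cases: "top_sign q g = 1 \<or> top_sign q g = -1"
  unfolding top_sign_def by (rule prod_sg_cases) simp

lemma bent_cases: "bent q g = 1 \<or> bent q g = -1"
proof -
  have "bent q g = (\<Prod>(j, i)\<in>UNIV \<times> {..<q}. sg (g j (q - 1 - i) \<and> g j (q + i)))"
    unfolding bent_def by (rule prod.cartesian_product)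
  also have "\<dots> = (\<Prod>x\<in>UNIV \<times> {..<q}. sg (case x of (j, i) \<Rightarrow> g j (q - 1 - i) \<and> g j (q + i)))"
    by (rule prod.cong) auto
  finally show ?thesis
    by (simp only:) (rule prod_sg_cases, simp)
qed

lemma bent_cong:
  assumes "\<And>j t. t < 2 * q \<Longrightarrow> g j t = h j t"
  shows "bent q g = bent q h"
  unfolding bent_def using assms by (intro prod.cong) auto

lemma top_sign_cong:
  assumes "\<And>j. g j (2 * q) = h j (2 * q)"
  shows "top_sign q g = top_sign q h"
  unfolding top_sign_def using assms by simp

text \<open>\<open>int_idx\<close> reverses the first \<open>q\<close> digits, just as the position
  \<open>q - 1 - i\<close> in \<open>bent\<close> does. This is the form in which the sign comes out
  of a full block sum.\<close>

lemma bent_eq_walsh1: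
  "bent q g = (\<Prod>j\<in>UNIV. walsh1 (int_idx q (g j)) (\<lambda>t. g j (t + q)))"
  unfolding bent_def
  by (intro prod.cong refl) (simp add: walsh1_eq[OF int_idx_less] bit_int_idx add.commute cong: prod.cong_simp)

lemma walsh_pow2: "walsh (\<lambda>_. 2 ^ (2 * q)) g = top_sign q g"
proof -
  have "walsh1 (2 ^ (2 * q)) h = sg (h (2 * q))" for h
    using walsh1_split[of 0 "2 * q" 1 h] by simp
  then show ?thesis by (simp add: walsh_def top_sign_def)
qed

text \<open>Index digits run backwards along the point: \<open>m j\<close> gives the first
  \<open>q\<close> digits of \<open>g j\<close> in reverse, while \<open>int_pt\<close> undoes the
  reversal of \<open>m' j\<close> in the next \<open>q\<close>.\<close>

lemma walshk_eq_bent: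
  assumes m: "m \<in> idx_below (2 ^ q)" "m' \<in> idx_below (2 ^ q)"
    and g: "g \<in> dyad_cube (2 * q) (\<lambda>j. 2 ^ q * m j + m' j)"
  shows "walshk q m m' = bent q g"
proof -
  have "walsh1 (m j) (int_pt q (m' j)) = (\<Prod>i<q. sg (g j (q - 1 - i) \<and> g j (q + i)))" for j
  proof -
    have m1: "m j < 2 ^ q" "m' j < 2 ^ q" using m by (auto simp: idx_below_def)
    have g1: "t < 2 * q \<Longrightarrow> g j t = bit (2 ^ q * m j + m' j) (2 * q - 1 - t)" for t
      using g by (auto simp: dyad_cube_def dyad_int_def)
    have "bit (m j) i = g j (q - 1 - i)" "int_pt q (m' j) i = g j (q + i)" if "i < q" for i
      using that by (auto simp: g1 bit_mult_add_iff[OF m1(2)] int_pt_def)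
    then show ?thesis unfolding walsh1_eq[OF m1(1)] by (intro prod.cong) auto
  qed
  then show ?thesis by (simp add: walshk_def walsh_def bent_def cube_pt_eq)
qed

lemma mem_Fpart_iff: "g \<in> Fpart q \<longleftrightarrow> top_sign q g = bent q g"
proof
  assume "g \<in> Fpart q"
  then show "top_sign q g = bent q g"
    unfolding Fpart_def by (auto simp: walsh_pow2 walshk_eq_bent)
next
  assume eq: "top_sign q g = bent q g"
  define m m' where "m = (\<lambda>j. int_idx q (g j))" and "m' = (\<lambda>j. int_idx q (\<lambda>t. g j (t + q)))"
  have mm: "m \<in> idx_below (2 ^ q)" "m' \<in> idx_below (2 ^ q)"
    by (auto simp: m_def m'_def idx_below_def int_idx_less)
  have "g \<in> dyad_cube (2 * q) (\<lambda>j. 2 ^ q * m j + m' j)"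
    unfolding dyad_cube_def dyad_int_def
  proof (clarify)
    fix j t assume t: "t < 2 * q"
    have "m' j < 2 ^ q" using mm by (auto simp: idx_below_def)
    from bit_mult_add_iff[OF this, of "m j" "2 * q - 1 - t"]
    show "g j t = bit (2 ^ q * m j + m' j) (2 * q - 1 - t)"
      using t by (auto simp: m_def m'_def bit_int_idx)
  qed
  then show "g \<in> Fpart q"
    unfolding Fpart_def using mm eq walshk_eq_bent[OF mm] by (fastforce simp: walsh_pow2)
qed

section \<open>The Riesz product and the digits it depends on\<close>

definition dens_factor :: "nat \<Rightarrow> 'n::finite pt \<Rightarrow> real" where
  "dens_factor q g = 1 + top_sign q g * bent q g"

text \<open>The density of \<open>\<tau>\<close> with respect to Haar measure at rank \<open>k\<close>, a Riesz product.\<close>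
definition dens :: "nat \<Rightarrow> 'n::finite pt \<Rightarrow> real" where
  "dens k g = (\<Prod>t | 2 * mseq t < k. dens_factor (mseq t) g)"

lemma dens_factor_cases: "dens_factor q g = (if g \<in> Fpart q then 2 else 0)"
  using top_sign_cases[of q g] bent_cases[of q g] by (auto simp: dens_factor_def mem_Fpart_iff)

lemma dens_factor_cong:
  assumes "\<And>j t. t \<le> 2 * q \<Longrightarrow> g j t = h j t"
  shows "dens_factor q g = dens_factor q h"
  unfolding dens_factor_def using assms
  by (simp add: bent_cong[of q g h] top_sign_cong[of g q h])

lemma finite_mseq_below [simp]: "finite {t. 2 * mseq t < k}"
proof (rule finite_subset)
  show "{t. 2 * mseq t < k} \<subseteq> {..<k}"
  proof
    fix t assume "t \<in> {t. 2 * mseq t < k}"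
    then show "t \<in> {..<k}" using le_mseq[of t] by simp
  qed
qed simp

lemma mseq_below_double: "{t. 2 * mseq t < 2 * mseq s} = {..<s}"
  by auto

lemma dens_0 [simp]: "dens 0 g = 1"
  by (simp add: dens_def)

lemma dens_cong:
  assumes "\<And>j t. t < k \<Longrightarrow> g j t = h j t"
  shows "dens k g = dens k h"
  unfolding dens_def by (intro prod.cong dens_factor_cong assms) auto

text \<open>A factor with \<open>t < s\<close> reads digits up to \<open>2 * mseq t\<close> only,
  which \<open>mseq_gap\<close> places below half of \<open>mseq s\<close>.\<close>

lemma dens_double_mseq_cong:
  assumes "\<And>j t. t < mseq s div 2 \<Longrightarrow> g j t = h j t"
  shows "dens (2 * mseq s) g = dens (2 * mseq s) h"
  unfolding dens_def mseq_below_double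
proof (intro prod.cong dens_factor_cong)
  fix t j u assume "t \<in> {..<s}" "u \<le> 2 * mseq t"
  then show "g j u = h j u" using mseq_gap[of t s] by (intro assms) auto
qed auto

lemma dens_nonneg: "0 \<le> dens k g"
  unfolding dens_def by (intro prod_nonneg) (auto simp: dens_factor_cases)

lemma dens_double_mseq_le: "dens (2 * mseq s) g \<le> 2 ^ s"
proof -
  have "dens (2 * mseq s) g \<le> (\<Prod>t<s. 2)"
    unfolding dens_def mseq_below_double by (intro prod_mono) (auto simp: dens_factor_cases)
  then show ?thesis by simp
qed

lemma dens_Suc:
  "dens (Suc k) g = dens k g * (if \<exists>s. k = 2 * mseq s then dens_factor (k div 2) g else 1)"
proof (cases "\<exists>s. k = 2 * mseq s")
  case True
  then obtain s where s: "k = 2 * mseq s" by auto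
  have "{t. 2 * mseq t < Suc k} = insert s {t. 2 * mseq t < k}"
    by (auto simp: s less_Suc_eq)
  then show ?thesis using s by (simp add: dens_def)
next
  case False
  then have "{t. 2 * mseq t < Suc k} = {t. 2 * mseq t < k}"
    by (auto simp: less_Suc_eq)
  then show ?thesis using False by (simp add: dens_def)
qed

lemma dens_eq_0_iff: "dens k g = 0 \<longleftrightarrow> (\<exists>t. 2 * mseq t < k \<and> g \<notin> Fpart (mseq t))"
  by (auto simp: dens_def dens_factor_cases)

section \<open>Fourier coefficients of the Riesz product\<close>

definition block :: "nat \<Rightarrow> 'n::finite idx set" where
  "block k = {n. \<forall>j. 2 ^ k \<le> n j \<and> n j < 2 ^ Suc k}"

text \<open>The formula comes from expanding the indicator of the cube of rank \<open>q\<close> and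
  index \<open>v\<close> in Walsh functions with low digits \<open>u\<close>. On that cube
  \<open>bent\<close> is the Walsh function with middle digits \<open>v\<close>, and the top digit
  gives \<open>top_sign\<close>.\<close>

definition block_val :: "nat \<Rightarrow> 'n::finite idx \<Rightarrow> real" where
  "block_val q n = dens (2 * q) (cube_pt q (\<lambda>j. n j div 2 ^ q mod 2 ^ q))
     * (\<Prod>j\<in>UNIV. walsh1 (n j mod 2 ^ q) (int_pt q (n j div 2 ^ q mod 2 ^ q)) / 2 ^ q)"

text \<open>Since the blocks are disjoint, the sum has at most one term.\<close>
definition acoef :: "'n::finite idx \<Rightarrow> real" where
  "acoef n = (if n = (\<lambda>_. 0) then 1 else \<Sum>s | n \<in> block (2 * mseq s). block_val (mseq s) n)"

lemma block_unique:
  assumes "n \<in> block k" "n \<in> block l"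
  shows "k = l"
proof -
  have "k < Suc l" if "n \<in> block k" "n \<in> block l" for k l
  proof -
    have "(2::nat) ^ k < 2 ^ Suc l"
      using that unfolding block_def by (auto intro: le_less_trans)
    then show ?thesis by (subst (asm) power_strict_increasing_iff) auto
  qed
  from this[OF assms] this[OF assms(2,1)] show ?thesis by simp
qed

lemma acoef_block:
  assumes "n \<in> block (2 * mseq s)"
  shows "acoef n = block_val (mseq s) n"
proof -
  have "{t. n \<in> block (2 * mseq t)} = {s}"
    using assms block_unique[OF assms] by fastforce
  moreover have "n \<noteq> (\<lambda>_. 0)" using assms by (auto simp: block_def)
  ultimately show ?thesis by (simp add: acoef_def)
qed

lemma acoef_nonzero:
  assumes "acoef n \<noteq> 0"
  shows "n = (\<lambda>_. 0) \<or> (\<exists>s. n \<in> block (2 * mseq s))"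
proof (rule ccontr)
  assume "\<not> ?thesis"
  then have "{s. n \<in> block (2 * mseq s)} = {}" "n \<noteq> (\<lambda>_. 0)" by auto
  with assms show False by (simp add: acoef_def)
qed

lemma finite_block [simp]: "finite (block k)"
  by (rule finite_subset[OF _ finite_idx_below[of "2 ^ Suc k"]]) (auto simp: block_def idx_below_def)

text \<open>Fixing the middle digits \<open>v\<close> fixes the density factor. The remaining
  indices form a box and the summand is a product over the coordinates, so the sum
  factorizes.\<close>

lemma sum_block:
  fixes g :: "'n::finite pt"
  assumes q: "q = mseq s"
  shows "(\<Sum>n | n \<in> block (2 * q) \<and> (\<forall>j. n j < N j). acoef n * walsh n g)
       = (\<Sum>v\<in>idx_below (2 ^ q). dens (2 * q) (cube_pt q v) * (\<Prod>j\<in>UNIV. block_inner q (N j) (v j) (g j)))"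
proof -
  define A :: "'n idx set" where "A = {n \<in> block (2 * q). \<forall>j. n j < N j}"
  define V :: "'n idx \<Rightarrow> 'n idx" where "V = (\<lambda>n j. n j div 2 ^ q mod 2 ^ q)"
  have fin: "finite A" by (simp add: A_def)
  have "(\<Sum>n\<in>A. acoef n * walsh n g) = (\<Sum>v\<in>idx_below (2 ^ q). \<Sum>n\<in>{n\<in>A. V n = v}. acoef n * walsh n g)"
    by (rule sum.group[symmetric, OF fin finite_idx_below]) (auto simp: V_def idx_below_def)
  also have "\<dots> = (\<Sum>v\<in>idx_below (2 ^ q). dens (2 * q) (cube_pt q v) * (\<Prod>j\<in>UNIV. block_inner q (N j) (v j) (g j)))"
  proof (rule sum.cong[OF refl])
    fix v :: "'n idx" assume "v \<in> idx_below (2 ^ q)"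
    then have v: "v j < 2 ^ q" for j by (auto simp: idx_below_def)
    define B where "B = (\<lambda>j. {n. 2 ^ (2 * q) \<le> n \<and> n < 2 ^ (2 * q + 1) \<and> n < N j \<and> n div 2 ^ q mod 2 ^ q = v j})"
    have AB: "{n\<in>A. V n = v} = {n. \<forall>j. n j \<in> B j}"
      by (auto simp: A_def B_def V_def block_def)
    have "(\<Sum>n\<in>{n\<in>A. V n = v}. acoef n * walsh n g)
        = (\<Sum>n | \<forall>j. n j \<in> B j. dens (2 * q) (cube_pt q v) *
             (\<Prod>j\<in>UNIV. walsh1 (n j mod 2 ^ q) (int_pt q (v j)) / 2 ^ q * walsh1 (n j) (g j)))"
      unfolding AB
    proof (rule sum.cong[OF refl])
      fix n assume n: "n \<in> {n. \<forall>j. n j \<in> B j}"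
      have "n \<in> A" "V n = v" using n AB by blast+
      then have nb: "n \<in> block (2 * mseq s)" "(\<lambda>j. n j div 2 ^ q mod 2 ^ q) = v"
        by (auto simp: A_def q V_def)
      have "n j div 2 ^ q mod 2 ^ q = v j" for j using nb(2) by metis
      then show "acoef n * walsh n g = dens (2 * q) (cube_pt q v) *
             (\<Prod>j\<in>UNIV. walsh1 (n j mod 2 ^ q) (int_pt q (v j)) / 2 ^ q * walsh1 (n j) (g j))"
        unfolding acoef_block[OF nb(1)] block_val_def q[symmetric] nb(2) walsh_def
        by (simp only: prod.distrib mult.assoc)
    qed
    also have "\<dots> = dens (2 * q) (cube_pt q v) * (\<Prod>j\<in>UNIV. \<Sum>n\<in>B j.
        walsh1 (n mod 2 ^ q) (int_pt q (v j)) / 2 ^ q * walsh1 n (g j))"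
      unfolding sum_distrib_left[symmetric]
      by (subst sum_box_prod[symmetric]) (auto simp: B_def)
    also have "\<dots> = dens (2 * q) (cube_pt q v) * (\<Prod>j\<in>UNIV. block_inner q (N j) (v j) (g j))"
      unfolding B_def by (simp only: sum_block_inner[OF v])
    finally show "(\<Sum>n\<in>{n\<in>A. V n = v}. acoef n * walsh n g)
      = dens (2 * q) (cube_pt q v) * (\<Prod>j\<in>UNIV. block_inner q (N j) (v j) (g j))" .
  qed
  finally show ?thesis by (simp add: A_def)
qed

text \<open>Only the index \<open>x\<close> of the cube of rank \<open>q\<close> containing
  \<open>g\<close> gives a nonzero product of kernels.\<close>

lemma sum_block_full:
  fixes g :: "'n::finite pt"
  assumes q: "q = mseq s" and N: "\<And>j. 2 ^ (2 * q + 1) \<le> N j"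
  shows "(\<Sum>n | n \<in> block (2 * q) \<and> (\<forall>j. n j < N j). acoef n * walsh n g)
       = dens (2 * q) g * (top_sign q g * bent q g)"
proof -
  define x where "x = (\<lambda>j. int_idx q (g j))"
  have x: "x \<in> idx_below (2 ^ q)" by (auto simp: x_def idx_below_def int_idx_less)
  have zero: "(\<Prod>j\<in>UNIV. block_inner q (N j) (v j) (g j)) = 0"
    if v: "v \<in> idx_below (2 ^ q) - {x}" for v
  proof -
    from v obtain j where "v j \<noteq> x j" by fastforce
    moreover have "v j < 2 ^ q" using v by (auto simp: idx_below_def)
    ultimately have "block_inner q (N j) (v j) (g j) = 0"
      by (simp add: block_inner_full[OF _ N] x_def)
    then show ?thesis by auto
  qed
  have dx: "dens (2 * q) (cube_pt q x) = dens (2 * q) g"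
    unfolding q by (rule dens_double_mseq_cong) (auto simp: cube_pt_eq x_def q int_pt_int_idx)
  have bx: "(\<Prod>j\<in>UNIV. block_inner q (N j) (x j) (g j)) = top_sign q g * bent q g"
    by (simp add: block_inner_full[OF int_idx_less N] x_def top_sign_def bent_eq_walsh1 prod.distrib)
  show ?thesis
    unfolding sum_block[OF q] sum.remove[OF finite_idx_below x]
    by (simp add: zero dx bx)
qed

text \<open>Blocks of lower rank lie inside the cube of side \<open>2 ^ k\<close>. Blocks of higher
  rank are excluded by the single short side \<open>j0\<close>, since every coordinate in them is
  large.\<close>

lemma sum_acoef_split:
  fixes g :: "'n::finite pt"
  assumes lo: "\<And>j. 2 ^ k \<le> N j" and hi: "N j0 \<le> 2 ^ Suc k"
  shows "(\<Sum>n | \<forall>j. n j < N j. acoef n * walsh n g)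
       = (\<Sum>n\<in>idx_below (2 ^ k). acoef n * walsh n g)
       + (\<Sum>n | n \<in> block k \<and> (\<forall>j. n j < N j). acoef n * walsh n g)"
proof -
  let ?B = "{n. n \<in> block k \<and> (\<forall>j. n j < N j)}"
  have "(\<Sum>n | \<forall>j. n j < N j. acoef n * walsh n g) = (\<Sum>n\<in>idx_below (2 ^ k) \<union> ?B. acoef n * walsh n g)"
  proof (rule sum.mono_neutral_right[OF finite_box])
    show "idx_below (2 ^ k) \<union> ?B \<subseteq> {n. \<forall>j. n j < N j}"
      using lo by (auto simp: idx_below_def intro: less_le_trans)
    show "\<forall>n\<in>{n. \<forall>j. n j < N j} - (idx_below (2 ^ k) \<union> ?B). acoef n * walsh n g = 0"
    proof (rule ballI, rule ccontr)
      fix n :: "'n idx"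
      assume n: "n \<in> {n. \<forall>j. n j < N j} - (idx_below (2 ^ k) \<union> ?B)" and "acoef n * walsh n g \<noteq> 0"
      then have "acoef n \<noteq> 0" by auto
      from acoef_nonzero[OF this] show False
      proof
        assume "n = (\<lambda>_. 0)"
        then have "n \<in> idx_below (2 ^ k)" by (simp add: idx_below_def)
        with n show False by blast
      next
        assume "\<exists>s. n \<in> block (2 * mseq s)"
        then obtain l where l: "n \<in> block l" by blast
        consider "l < k" | "l = k" | "k < l" by linarith
        then show False
        proof cases
          case 1
          then have "(2::nat) ^ Suc l \<le> 2 ^ k" by (intro power_increasing) auto
          then have "n \<in> idx_below (2 ^ k)"
            using l by (auto simp: block_def idx_below_def intro: less_le_trans)
          with n show False by blast
        next
          case 2
          with l n show False by blast
        next
          case 3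
          then have "(2::nat) ^ Suc k \<le> 2 ^ l" by (intro power_increasing) auto
          also have "\<dots> \<le> n j0" using l by (auto simp: block_def)
          also have "n j0 < N j0" using n by auto
          finally show False using hi by simp
        qed
      qed
    qed
  qed
  also have "\<dots> = (\<Sum>n\<in>idx_below (2 ^ k). acoef n * walsh n g) + (\<Sum>n\<in>?B. acoef n * walsh n g)"
  proof (rule sum.union_disjoint)
    have "n \<notin> block k" if "n \<in> idx_below (2 ^ k)" for n :: "'n idx"
      using that by (auto simp: block_def idx_below_def not_le[symmetric])
    then show "idx_below (2 ^ k) \<inter> ?B = {}" by blast
  qed auto
  finally show ?thesis .
qed

lemma sum_block_zero:
  assumes "\<nexists>s. k = 2 * mseq s"
  shows "(\<Sum>n | n \<in> block k \<and> (\<forall>j. n j < N j). acoef n * walsh n g) = 0"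
proof (rule sum.neutral, rule ballI)
  fix n assume n: "n \<in> {n. n \<in> block k \<and> (\<forall>j. n j < N j)}"
  have "n \<noteq> (\<lambda>_. 0)" using n by (auto simp: block_def)
  moreover have "n \<notin> block (2 * mseq s)" for s using n assms block_unique by auto
  ultimately have "acoef n = 0" using acoef_nonzero by blast
  then show "acoef n * walsh n g = 0" by simp
qed

text \<open>Doubling the side adds one block, which contributes the new summand of the Riesz product
  if \<open>k = 2 * mseq s\<close> and nothing otherwise.\<close>

lemma sum_acoef_eq_dens:
  fixes g :: "'n::finite pt"
  shows "(\<Sum>n\<in>idx_below (2 ^ k). acoef n * walsh n g) = dens k g"
proof (induction k)
  case 0
  have "idx_below (2 ^ 0) = {(\<lambda>_. 0) :: 'n idx}" by (auto simp: idx_below_def)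
  then show ?case by (simp add: acoef_def walsh_def)
next
  case (Suc k)
  have "(\<Sum>n\<in>idx_below (2 ^ Suc k). acoef n * walsh n g) =
      (\<Sum>n | \<forall>j. n j < (\<lambda>_. 2 ^ Suc k) j. acoef n * walsh n g)"
    by (simp add: idx_below_def)
  also have "\<dots> = dens k g + (\<Sum>n | n \<in> block k \<and> (\<forall>j. n j < (\<lambda>_. 2 ^ Suc k) j). acoef n * walsh n g)"
    by (subst sum_acoef_split[where k = k]) (auto simp: Suc)
  also have "\<dots> = dens (Suc k) g"
  proof (cases "\<exists>s. k = 2 * mseq s")
    case True
    then obtain s where s: "k = 2 * mseq s" by auto
    then show ?thesis
      using sum_block_full[OF refl, of s "\<lambda>_. 2 ^ Suc k" g] True
      by (simp add: dens_Suc dens_factor_def distrib_left)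
  next
    case False
    show ?thesis
      unfolding sum_block_zero[OF False] using False by (simp add: dens_Suc)
  qed
  finally show ?case .
qed

text \<open>In each coordinate only the index of \<open>g j\<close> and the one cut by
  \<open>N j\<close> can give a nonzero kernel, which leaves at most \<open>2 ^ CARD('n)\<close>
  terms.\<close>

lemma abs_sum_block_le:
  fixes g :: "'n::finite pt"
  assumes q: "q = mseq s" and g: "dens (2 * q) g = 0"
  shows "\<bar>\<Sum>n | n \<in> block (2 * q) \<and> (\<forall>j. n j < N j). acoef n * walsh n g\<bar>
       \<le> 2 ^ CARD('n) * (2 ^ s * (2 ^ (q div 2) / 2 ^ q))"
proof -
  define x where "x = (\<lambda>j. int_idx q (g j))"
  define V where "V = (\<lambda>j. (N j - 2 ^ (2 * q)) div 2 ^ q)"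
  define I where "I = PiE UNIV (\<lambda>j. {x j, V j})"
  let ?f = "\<lambda>v. dens (2 * q) (cube_pt q v) * (\<Prod>j\<in>UNIV. block_inner q (N j) (v j) (g j))"
  have finI: "finite I" by (auto simp: I_def intro: finite_PiE)
  have bound: "\<bar>?f v\<bar> \<le> 2 ^ s * (2 ^ (q div 2) / 2 ^ q)" for v
  \<comment> \<open>Agreement on the first \<open>q div 2\<close> digits makes the density equal to
    that of \<open>g\<close>, which is zero. Otherwise one kernel is small and the others are at
    most 1.\<close>
  proof (cases "\<forall>j. \<forall>t<q div 2. cube_pt q v j t = g j t")
    case True
    then have "dens (2 * q) (cube_pt q v) = dens (2 * q) g"
      unfolding q by (intro dens_double_mseq_cong) auto
    then show ?thesis using g by simp
  next
    case False
    then obtain j0 t where j0: "t < q div 2" "int_pt q (v j0) t \<noteq> g j0 t"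
      by (auto simp: cube_pt_eq)
    have "\<bar>\<Prod>j\<in>UNIV. block_inner q (N j) (v j) (g j)\<bar>
        = \<bar>block_inner q (N j0) (v j0) (g j0)\<bar> * (\<Prod>j\<in>UNIV-{j0}. \<bar>block_inner q (N j) (v j) (g j)\<bar>)"
      unfolding abs_prod by (rule prod.remove) auto
    also have "\<dots> \<le> (2 ^ (q div 2) / 2 ^ q) * 1"
      by (intro mult_mono abs_block_inner_le[where t = t] j0 prod_le_1 prod_nonneg)
         (auto simp: abs_block_inner_le_1)
    finally have "\<bar>\<Prod>j\<in>UNIV. block_inner q (N j) (v j) (g j)\<bar> \<le> 2 ^ (q div 2) / 2 ^ q" by simp
    moreover have "\<bar>dens (2 * q) (cube_pt q v)\<bar> \<le> 2 ^ s"
      unfolding q using dens_double_mseq_le[of s "cube_pt (mseq s) v"] dens_nonneg[of "2 * mseq s" "cube_pt (mseq s) v"] by simp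
    ultimately show ?thesis unfolding abs_mult by (intro mult_mono) auto
  qed
  have "card I = (\<Prod>j\<in>UNIV. card {x j, V j})"
    unfolding I_def by (intro card_PiE) auto
  also have "\<dots> \<le> (\<Prod>j\<in>(UNIV :: 'n set). 2)"
    by (intro prod_mono) (auto simp: card_insert_if)
  finally have cardI: "real (card I) \<le> 2 ^ CARD('n)"
    by (metis of_nat_le_iff of_nat_numeral of_nat_power prod_constant)
  have "(\<Sum>v\<in>idx_below (2 ^ q). ?f v) = (\<Sum>v\<in>idx_below (2 ^ q) \<inter> I. ?f v)"
  proof (rule sum.mono_neutral_right)
    show "\<forall>v\<in>idx_below (2 ^ q) - idx_below (2 ^ q) \<inter> I. ?f v = 0"
    proof
      fix v assume v: "v \<in> idx_below (2 ^ q) - idx_below (2 ^ q) \<inter> I"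
      then obtain j where "v j \<noteq> x j" "v j \<noteq> V j" by (auto simp: I_def)
      moreover have "v j < 2 ^ q" using v by (auto simp: idx_below_def)
      ultimately have "block_inner q (N j) (v j) (g j) = 0"
        using block_inner_nonzero[of "v j" q "N j" "g j"] by (auto simp: x_def V_def)
      then show "?f v = 0" by auto
    qed
  qed auto
  also have "\<bar>\<dots>\<bar> \<le> (\<Sum>v\<in>idx_below (2 ^ q) \<inter> I. \<bar>?f v\<bar>)" by (rule sum_abs)
  also have "\<dots> \<le> (\<Sum>v\<in>I. \<bar>?f v\<bar>)" by (rule sum_mono2[OF finI]) auto
  also have "\<dots> \<le> real (card I) * (2 ^ s * (2 ^ (q div 2) / 2 ^ q))"
    by (rule sum_bounded_above) (rule bound)
  also have "\<dots> \<le> 2 ^ CARD('n) * (2 ^ s * (2 ^ (q div 2) / 2 ^ q))"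
    using cardI by (intro mult_right_mono) auto
  finally show ?thesis unfolding sum_block[OF q] .
qed

section \<open>The quasimeasure of F and its generating series\<close>

text \<open>A point of the set is built by continuing the cube with zeros and correcting a single
  digit.\<close>

lemma dyad_cube_meets_Fset:
  fixes m :: "'n::finite idx"
  assumes nz: "dens k (cube_pt k m) \<noteq> 0"
  shows "dyad_cube k m \<inter> Fset \<noteq> {}"
proof -
  define c where "c = cube_pt k m"
  have c: "\<not> c j t" if "k \<le> t" for j t using that by (simp add: c_def cube_pt_def)
  \<comment> \<open>This is the first condition whose sign digit is still free in the cube; all
    earlier ones are decided by the nonzero density.\<close>
  define s where "s = (LEAST s. k \<le> 2 * mseq s)"
  define q where "q = mseq s"
  have "k \<le> 2 * mseq k" using le_mseq[of k] by simp
  then have kq: "k \<le> 2 * q" unfolding q_def s_def by (rule LeastI)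
  have less: "2 * mseq t < k" if "t < s" for t
    using not_less_Least[OF that[unfolded s_def]] by simp
  fix j0 :: 'n
  \<comment> \<open>The digit at \<open>2 * q\<close> adjusts \<open>top_sign q\<close> to
    \<open>bent q\<close>, which reads only digits below \<open>2 * q\<close> and so does not
    change.\<close>
  define g where "g = (\<lambda>j t. if j = j0 \<and> t = 2 * q then bent q c = -1 else c j t)"
  have agree: "g j t = c j t" if "t < 2 * q" for j t using that by (simp add: g_def)
  have high: "\<not> g j t" if "2 * q < t" for j t using that kq by (simp add: g_def c)
  have "g \<in> Fpart (mseq t)" for t
  proof -
    consider "t < s" | "t = s" | "s < t" by linarith
    then show ?thesis
    proof cases
      case 1
      have "dens k g = dens k c" using kq by (intro dens_cong agree) simp
      then have "dens k g \<noteq> 0" using nz by (simp add: c_def)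
      then show ?thesis using less[OF 1] by (auto simp: dens_eq_0_iff)
    next
      case 2
      have "sg (g j (2 * q)) = (if j = j0 then sg (bent q c = -1) else 1)" for j
        using kq by (simp add: g_def c)
      then have "top_sign q g = sg (bent q c = -1)"
        by (simp add: top_sign_def)
      also have "\<dots> = bent q g"
        using bent_cases[of q c] bent_cong[of q g c, OF agree] by auto
      finally show ?thesis unfolding 2 q_def mem_Fpart_iff .
    next
      case 3
      \<comment> \<open>The second digit group and the sign digit of every later condition are zero,
        so both sides equal 1.\<close>
      have "2 * q < mseq t" using mseq_gap[OF 3] by (simp add: q_def)
      then show ?thesis by (simp add: mem_Fpart_iff top_sign_def bent_def high)
    qed
  qed
  then have "g \<in> Fset" by (auto simp: Fset_def)
  moreover have "g \<in> dyad_cube k m"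
    using kq by (auto simp: mem_dyad_cube_iff agree c_def)
  ultimately show ?thesis by blast
qed

lemma dyad_cube_meets_Fset_iff:
  "dyad_cube k m \<inter> Fset \<noteq> {} \<longleftrightarrow> dens k (cube_pt k m) \<noteq> 0"
proof
  assume "dyad_cube k m \<inter> Fset \<noteq> {}"
  then obtain g where g: "g \<in> dyad_cube k m" "g \<in> Fset" by blast
  have "dens k (cube_pt k m) = dens k g"
    using g(1) by (intro dens_cong) (auto simp: mem_dyad_cube_iff)
  also have "\<dots> \<noteq> 0" using g(2) by (auto simp: dens_eq_0_iff Fset_def)
  finally show "dens k (cube_pt k m) \<noteq> 0" .
qed (rule dyad_cube_meets_Fset)

text \<open>Flipping one coordinate is a bijection between the two sign classes.\<close>

lemma card_sign_class:
  fixes \<beta> :: real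
  assumes "\<beta> = 1 \<or> \<beta> = -1"
  shows "2 * card {\<sigma> :: 'n::finite \<Rightarrow> bool. (\<Prod>j\<in>UNIV. sg (\<sigma> j)) = \<beta>} = 2 ^ CARD('n)"
proof -
  let ?S = "\<lambda>\<beta>. {\<sigma> :: 'n \<Rightarrow> bool. (\<Prod>j\<in>UNIV. sg (\<sigma> j)) = \<beta>}"
  fix j0 :: 'n
  define flip where "flip = (\<lambda>\<sigma> :: 'n \<Rightarrow> bool. \<sigma>(j0 := \<not> \<sigma> j0))"
  have flip: "(\<Prod>j\<in>UNIV. sg (flip \<sigma> j)) = - (\<Prod>j\<in>UNIV. sg (\<sigma> j))" for \<sigma>
  proof -
    have "(\<Prod>j\<in>UNIV - {j0}. sg (flip \<sigma> j)) = (\<Prod>j\<in>UNIV - {j0}. sg (\<sigma> j))"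
      by (rule prod.cong) (auto simp: flip_def)
    moreover have "sg (flip \<sigma> j0) = - sg (\<sigma> j0)" by (simp add: flip_def sg_def)
    ultimately show ?thesis
      using prod.remove[of UNIV j0 "\<lambda>j. sg (flip \<sigma> j)"] prod.remove[of UNIV j0 "\<lambda>j. sg (\<sigma> j)"]
      by simp
  qed
  have ff: "flip (flip \<sigma>) = \<sigma>" for \<sigma> by (simp add: flip_def)
  have "bij_betw flip (?S 1) (?S (-1))"
    by (rule bij_betw_byWitness[where f' = flip]) (auto simp: ff flip)
  then have eq: "card (?S 1) = card (?S (-1))" by (rule bij_betw_same_card)
  have "card (?S 1) + card (?S (-1)) = card (?S 1 \<union> ?S (-1))"
    by (subst card_Un_disjoint) auto
  also have "?S 1 \<union> ?S (-1) = UNIV" using prod_sg_cases[of "UNIV :: 'n set"] by auto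
  also have "card (UNIV :: ('n \<Rightarrow> bool) set) = 2 ^ CARD('n)" by (simp add: card_fun)
  finally show ?thesis using assms eq by auto
qed

lemma dens_child:
  fixes p :: "'n::finite idx"
  assumes "k = 2 * q"
  shows "dens_factor q (cube_pt (Suc k) (\<lambda>j. 2 * p j + (if \<sigma> j then 1 else 0)))
       = 1 + (\<Prod>j\<in>UNIV. sg (\<sigma> j)) * bent q (cube_pt k p)"
proof -
  let ?c = "cube_pt (Suc k) (\<lambda>j. 2 * p j + (if \<sigma> j then 1 else 0))"
  have "?c j (2 * q) = \<sigma> j" for j by (auto simp: cube_pt_def assms bit_0)
  moreover have "?c j t = cube_pt k p j t" if "t < 2 * q" for j t
  proof -
    have "k - t = Suc (k - 1 - t)" using that assms by auto
    then show ?thesis using that assms by (auto simp: cube_pt_def bit_Suc)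
  qed
  ultimately show ?thesis
    unfolding dens_factor_def top_sign_def by (simp add: bent_cong[of q ?c "cube_pt k p"])
qed

lemma dens_cube_pt_div2:
  "dens k (cube_pt (Suc k) m) = dens k (cube_pt k (\<lambda>j. m j div 2))"
proof (rule dens_cong)
  fix j t assume "t < k"
  then have "k - t = Suc (k - 1 - t)" by auto
  then show "cube_pt (Suc k) m j t = cube_pt k (\<lambda>j. m j div 2) j t"
    using \<open>t < k\<close> by (auto simp: cube_pt_def bit_Suc)
qed

text \<open>All surviving children of a cube have the same density, so the equal split in
  \<open>tauF\<close> matches the Riesz product once the survivors are counted.\<close>

lemma tauF_Fset_eq:
  fixes m :: "'n::finite idx"
  shows "tauF Fset k m = dens k (cube_pt k m) / 2 ^ (CARD('n) * k)"
proof (induction k arbitrary: m)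
  case 0
  then show ?case using dyad_cube_meets_Fset_iff[of 0 m] by simp
next
  case (Suc k)
  define p where "p = (\<lambda>j. m j div 2)"
  define C where "C = (\<lambda>\<sigma> :: 'n \<Rightarrow> bool. cube_pt (Suc k) (\<lambda>j. 2 * p j + (if \<sigma> j then 1 else 0)))"
  define M where "M = card {\<sigma>. dens (Suc k) (C \<sigma>) \<noteq> 0}"
  have rec: "tauF Fset (Suc k) m = (if dens (Suc k) (cube_pt (Suc k) m) \<noteq> 0 then tauF Fset k p / real M else 0)"
    by (simp add: dyad_cube_meets_Fset_iff Let_def p_def M_def C_def)
  have Cm: "cube_pt (Suc k) m = C (\<lambda>j. odd (m j))"
  proof -
    have "m = (\<lambda>j. 2 * p j + (if odd (m j) then 1 else 0))"
      by (rule ext) (auto simp: p_def elim: oddE)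
    then show ?thesis unfolding C_def by (rule arg_cong)
  qed
  have dC: "dens k (C \<sigma>) = dens k (cube_pt k p)" for \<sigma>
    unfolding C_def dens_cube_pt_div2 by (rule arg_cong[where f = "\<lambda>x. dens k (cube_pt k x)"]) auto
  show ?case
  proof (cases "dens (Suc k) (cube_pt (Suc k) m) = 0")
    case True
    then show ?thesis using rec by simp
  next
    case False
    then have nz: "dens k (cube_pt k p) \<noteq> 0"
      unfolding Cm dens_Suc dC by auto
    \<comment> \<open>At rank \<open>2 * mseq s\<close> the density doubles and half of the children
      survive; at other ranks it is unchanged and all survive.\<close>
    have key: "dens (Suc k) (cube_pt (Suc k) m) * real M = dens k (cube_pt k p) * 2 ^ CARD('n)"
    proof (cases "\<exists>s. k = 2 * mseq s")
      case True
      define q where "q = k div 2"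
      have q: "k = 2 * q" using True by (auto simp: q_def)
      define \<beta> where "\<beta> = bent q (cube_pt k p)"
      have \<beta>: "\<beta> = 1 \<or> \<beta> = -1" unfolding \<beta>_def by (rule bent_cases)
      have fac: "dens (Suc k) (C \<sigma>) = dens k (cube_pt k p) * (1 + (\<Prod>j\<in>UNIV. sg (\<sigma> j)) * \<beta>)" for \<sigma>
      proof -
        have "dens_factor q (C \<sigma>) = 1 + (\<Prod>j\<in>UNIV. sg (\<sigma> j)) * \<beta>"
          unfolding C_def \<beta>_def by (rule dens_child[OF q])
        then show ?thesis using True by (simp add: dens_Suc dC q_def[symmetric])
      qed
      have "(\<Prod>j\<in>UNIV. sg (\<sigma> j)) = 1 \<or> (\<Prod>j\<in>UNIV. sg (\<sigma> j)) = -1" for \<sigma> :: "'n \<Rightarrow> bool"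
        by (rule prod_sg_cases) simp
      note cases = this
      have iff: "1 + (\<Prod>j\<in>UNIV. sg (\<sigma> j)) * \<beta> \<noteq> 0 \<longleftrightarrow> (\<Prod>j\<in>UNIV. sg (\<sigma> j)) = \<beta>" for \<sigma> :: "'n \<Rightarrow> bool"
        using \<beta> cases[of \<sigma>] by auto
      have "2 * M = 2 ^ CARD('n)"
        unfolding M_def fac using nz iff card_sign_class[OF \<beta>] by simp
      then have M: "2 * real M = 2 ^ CARD('n)"
        by (metis of_nat_mult of_nat_numeral of_nat_power)
      have "(\<Prod>j\<in>UNIV. sg (odd (m j))) = \<beta>"
        using False iff[of "\<lambda>j. odd (m j)"] unfolding Cm fac by auto
      then have "dens (Suc k) (cube_pt (Suc k) m) = dens k (cube_pt k p) * 2"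
        unfolding Cm fac using \<beta> by auto
      then show ?thesis using M by simp
    next
      case False
      then have "dens (Suc k) (C \<sigma>) = dens k (cube_pt k p)" for \<sigma>
        by (simp add: dens_Suc dC)
      then show ?thesis using nz by (simp add: Cm M_def card_fun)
    qed
    then have "M \<noteq> 0" using nz by (intro notI) simp
    then have "dens (Suc k) (cube_pt (Suc k) m) = dens k (cube_pt k p) * 2 ^ CARD('n) / real M"
      using key by (simp add: field_simps)
    then have "dens (Suc k) (cube_pt (Suc k) m) / 2 ^ (CARD('n) * Suc k)
        = dens k (cube_pt k p) / 2 ^ (CARD('n) * k) / real M"
      by (simp add: power_add)
    also have "\<dots> = tauF Fset (Suc k) m"
      unfolding rec Suc.IH using False by simp
    finally show ?thesis ..
  qed
qed

text \<open>By \<open>walsh1_int_pt_sym\<close> the cube index becomes the index of the Walsh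
  function, and each coordinate sum is a complete Dirichlet kernel.\<close>

lemma walshk_orthogonal:
  fixes n n' :: "'n::finite idx"
  assumes n: "n \<in> idx_below (2 ^ K)" and n': "n' \<in> idx_below (2 ^ K)"
  shows "(\<Sum>m\<in>idx_below (2 ^ K). walshk K n m * walshk K n' m) = (if n = n' then 2 ^ (CARD('n) * K) else 0)"
proof -
  have lt: "n j < 2 ^ K" "n' j < 2 ^ K" for j using n n' by (auto simp: idx_below_def)
  have one: "(\<Sum>u<2 ^ K. walsh1 (n j) (int_pt K u) * walsh1 (n' j) (int_pt K u)) = (if n j = n' j then 2 ^ K else 0)" for j
  proof -
    have "(\<Sum>u<2 ^ K. walsh1 (n j) (int_pt K u) * walsh1 (n' j) (int_pt K u))
        = (\<Sum>u<2 ^ K. walsh1 u (\<lambda>t. int_pt K (n j) t \<noteq> int_pt K (n' j) t))"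
    proof (rule sum.cong)
      fix u :: nat assume "u \<in> {..<2 ^ K}"
      then show "walsh1 (n j) (int_pt K u) * walsh1 (n' j) (int_pt K u)
          = walsh1 u (\<lambda>t. int_pt K (n j) t \<noteq> int_pt K (n' j) t)"
        using lt[of j] walsh1_int_pt_sym[of u K "n j"] walsh1_int_pt_sym[of u K "n' j"]
        by (simp only: lessThan_iff walsh1_mult)
    qed simp
    also have "\<dots> = (if \<forall>t<K. int_pt K (n j) t = int_pt K (n' j) t then 2 ^ K else 0)"
      unfolding sum_walsh1_pow2 by simp
    also have "(\<forall>t<K. int_pt K (n j) t = int_pt K (n' j) t) \<longleftrightarrow> n j = n' j"
      using int_pt_inj[OF lt] by auto
    finally show ?thesis .
  qed
  have "(\<Sum>m\<in>idx_below (2 ^ K). walshk K n m * walshk K n' m)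
      = (\<Sum>m | \<forall>j. m j \<in> {..<2 ^ K}. \<Prod>j\<in>UNIV. walsh1 (n j) (int_pt K (m j)) * walsh1 (n' j) (int_pt K (m j)))"
    by (simp add: idx_below_def walshk_def walsh_def cube_pt_eq prod.distrib)
  also have "\<dots> = (\<Prod>j\<in>UNIV. \<Sum>u<2 ^ K. walsh1 (n j) (int_pt K u) * walsh1 (n' j) (int_pt K u))"
    by (rule sum_box_prod) simp
  also have "\<dots> = (\<Prod>j\<in>(UNIV :: 'n set). if n j = n' j then 2 ^ K else 0)"
    by (simp only: one)
  also have "\<dots> = (if n = n' then 2 ^ (CARD('n) * K) else 0)"
  proof (cases "n = n'")
    case True
    then show ?thesis by (simp add: power_mult[symmetric] mult.commute)
  next
    case False
    then obtain j where "n j \<noteq> n' j" by auto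
    then show ?thesis using False by auto
  qed
  finally show ?thesis .
qed

text \<open>The density is the partial sum with coefficients \<open>acoef\<close>; orthogonality on
  the cubes of rank \<open>K\<close> extracts one of them.\<close>

lemma tau_coef_Fset:
  fixes n :: "'n::finite idx"
  shows "tau_coef (tauF Fset) n = acoef n"
proof -
  define K where "K = Max (range n)"
  have "n j < 2 ^ K" for j
  proof -
    have "n j \<le> K" unfolding K_def by (rule Max_ge) auto
    then show ?thesis using less_exp[of K] by (rule le_less_trans)
  qed
  then have n: "n \<in> idx_below (2 ^ K)" by (auto simp: idx_below_def)
  let ?c = "2 ^ (CARD('n) * K) :: real"
  have "tau_coef (tauF Fset) n = (\<Sum>m\<in>idx_below (2 ^ K). walshk K n m * (dens K (cube_pt K m) / ?c))"
    unfolding tau_coef_def K_def[symmetric] Let_def tauF_Fset_eq ..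
  also have "\<dots> = (\<Sum>m\<in>idx_below (2 ^ K). \<Sum>n'\<in>idx_below (2 ^ K). acoef n' / ?c * (walshk K n m * walshk K n' m))"
    by (simp add: sum_acoef_eq_dens[symmetric] sum_distrib_left sum_divide_distrib walshk_def ac_simps)
  also have "\<dots> = (\<Sum>n'\<in>idx_below (2 ^ K). acoef n' / ?c * (\<Sum>m\<in>idx_below (2 ^ K). walshk K n m * walshk K n' m))"
    by (subst sum.swap) (simp add: sum_distrib_left)
  also have "\<dots> = (\<Sum>n'\<in>idx_below (2 ^ K). if n = n' then acoef n' else 0)"
    by (rule sum.cong) (auto simp: walshk_orthogonal[OF n])
  also have "\<dots> = acoef n" using n by simp
  finally show ?thesis .
qed

lemma tau_series_Fset: "tau_series (tauF Fset) n = complex_of_real (acoef n)"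
  by (simp add: tau_series_def tau_coef_Fset)

lemma psum_tau_series:
  "psum (tau_series (tauF Fset)) N g = complex_of_real (\<Sum>n | \<forall>j. n j < N j. acoef n * walsh n g)"
  by (simp add: psum_def tau_series_Fset)

section \<open>Convergence off F\<close>

lemma four_times_le_mseq: "4 * s \<le> mseq s + 2"
proof (induction s)
  case (Suc s)
  then show ?case using le_mseq[of s] by (cases s) auto
qed simp

text \<open>Since \<open>mseq s div 2 + 1 \<ge> 2 * s\<close>, the decay of the kernel beats the
  growth \<open>2 ^ s\<close> of the Riesz product.\<close>

lemma mseq_pow_bound: "2 ^ s * (2 ^ (mseq s div 2) / 2 ^ mseq s) \<le> 2 * (1 / 2 :: real) ^ s"
proof -
  have "even (mseq s)" by (cases s) auto
  then have q: "mseq s = mseq s div 2 + mseq s div 2" by presburger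
  have "2 * s \<le> mseq s div 2 + 1" using four_times_le_mseq[of s] by linarith
  then have "(2::real) ^ (2 * s) \<le> 2 ^ (mseq s div 2 + 1)" by (intro power_increasing) auto
  moreover have "(2::real) ^ mseq s = 2 ^ (mseq s div 2) * 2 ^ (mseq s div 2)"
    by (subst q) (rule power_add)
  moreover have "(2::real) ^ (2 * s) = 2 ^ s * 2 ^ s" by (simp add: mult_2 power_add)
  ultimately show ?thesis by (simp add: power_one_over divide_simps)
qed

lemma partial_sums_null:
  fixes g :: "'n::finite pt"
  assumes g: "g \<notin> Fset" and \<epsilon>: "0 < \<epsilon>"
  shows "\<exists>M. \<forall>N. (\<forall>j. M \<le> N j) \<longrightarrow> \<bar>\<Sum>n | \<forall>j. n j < N j. acoef n * walsh n g\<bar> < \<epsilon>"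
proof -
  from g obtain t where t: "g \<notin> Fpart (mseq t)" by (auto simp: Fset_def)
  define C :: real where "C = 2 ^ CARD('n) * 2"
  have C: "0 < C" by (simp add: C_def)
  obtain r where r: "(1 / 2 :: real) ^ r < \<epsilon> / C"
    using real_arch_pow_inv[of "\<epsilon> / C" "1 / 2"] \<epsilon> C by auto
  \<comment> \<open>\<open>Suc t\<close> makes the factor violated by \<open>g\<close> enter the
    density, and \<open>r\<close> makes the block bound small.\<close>
  define s0 where "s0 = max r (Suc t)"
  show ?thesis
  proof (intro exI allI impI)
    fix N :: "'n idx" assume N: "\<forall>j. 2 ^ (2 * mseq s0) \<le> N j"
    \<comment> \<open>The shortest side decides which dyadic range is reached, and so which block
      may be incomplete.\<close>
    define L where "L = Min (range N)"
    have L: "L \<le> N j" for j unfolding L_def by (rule Min_le) auto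
    have "L \<in> range N" unfolding L_def by (rule Min_in) auto
    then obtain j0 where j0: "N j0 = L" by auto
    have LM: "2 ^ (2 * mseq s0) \<le> L" using N j0 by metis
    then have "0 < L" by (metis not_gr0 le_zero_eq power_not_zero zero_neq_numeral)
    then obtain k where k: "2 ^ k \<le> L" "L < 2 ^ (k + 1)" using ex_power_ivl1[of 2 L] by auto
    have "(2::nat) ^ (2 * mseq s0) < 2 ^ (k + 1)" using LM k(2) by (rule le_less_trans)
    then have ks0: "2 * mseq s0 \<le> k" by (subst (asm) power_strict_increasing_iff) auto
    have "mseq t < mseq s0" by (simp add: s0_def)
    then have "2 * mseq t < k" using ks0 by linarith
    then have dk: "dens k g = 0"
      using t by (auto simp: dens_eq_0_iff)
    have "(\<Sum>n | \<forall>j. n j < N j. acoef n * walsh n g)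
        = (\<Sum>n\<in>idx_below (2 ^ k). acoef n * walsh n g)
        + (\<Sum>n | n \<in> block k \<and> (\<forall>j. n j < N j). acoef n * walsh n g)"
      by (rule sum_acoef_split[of k N j0]) (use k L j0 in \<open>auto intro: order_trans\<close>)
    then have eq: "(\<Sum>n | \<forall>j. n j < N j. acoef n * walsh n g)
        = (\<Sum>n | n \<in> block k \<and> (\<forall>j. n j < N j). acoef n * walsh n g)"
      by (simp add: sum_acoef_eq_dens dk)
    show "\<bar>\<Sum>n | \<forall>j. n j < N j. acoef n * walsh n g\<bar> < \<epsilon>"
    proof (cases "\<exists>s. k = 2 * mseq s")
      case True
      then obtain s where s: "k = 2 * mseq s" by auto
      have "s0 \<le> s" using ks0 strict_mono_less_eq[OF strict_mono_mseq, of s0 s] by (simp add: s)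
      then have rs: "r \<le> s" by (simp add: s0_def)
      have "\<bar>\<Sum>n | n \<in> block k \<and> (\<forall>j. n j < N j). acoef n * walsh n g\<bar>
          \<le> 2 ^ CARD('n) * (2 ^ s * (2 ^ (mseq s div 2) / 2 ^ mseq s))"
        unfolding s by (rule abs_sum_block_le[OF refl]) (use dk s in simp)
      also have "\<dots> \<le> 2 ^ CARD('n) * (2 * (1 / 2) ^ s)"
        by (intro mult_left_mono mseq_pow_bound) simp
      also have "\<dots> = C * (1 / 2) ^ s" by (simp add: C_def)
      also have "\<dots> \<le> C * (1 / 2) ^ r"
        using C rs by (intro mult_left_mono power_decreasing) auto
      also have "\<dots> < \<epsilon>" using r C by (simp add: field_simps)
      finally show ?thesis unfolding eq .
    next
      case False
      then show ?thesis unfolding eq sum_block_zero[OF False] using \<epsilon> by simp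
    qed
  qed
qed

lemma conv_rect_tau_series:
  assumes "g \<notin> Fset"
  shows "conv_rect (tau_series (tauF Fset)) g 0"
  unfolding conv_rect_def psum_tau_series using partial_sums_null[OF assms]
  by (simp only: diff_0_right norm_of_real real_norm_def) simp

section \<open>From rectangular to cubic and iterated convergence\<close>

lemma conv_cube_if_conv_rect:
  assumes "conv_rect a g S"
  shows "conv_cube a g S"
  unfolding conv_cube_def LIMSEQ_iff
proof (intro allI impI)
  fix r :: real assume "0 < r"
  then obtain M where "\<And>N. (\<forall>j. M \<le> N j) \<Longrightarrow> norm (psum a N g - S) < r"
    using assms unfolding conv_rect_def by blast
  then show "\<exists>no. \<forall>n\<ge>no. norm (psum a (\<lambda>_. n) g - S) < r"
    by (intro exI[of _ M] allI impI) simp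
qed

lemma finite_partial_box:
  "finite {n' :: 'n::finite idx. (\<forall>j\<in>A. n' j < B) \<and> (\<forall>j. j \<notin> A \<longrightarrow> n' j = n j)}"
proof (rule finite_subset[OF _ finite_box], clarify)
  fix n' :: "'n idx" and j
  assume "\<forall>j\<in>A. n' j < B" "\<forall>j. j \<notin> A \<longrightarrow> n' j = n j"
  then show "n' j < B + Suc (n j)" by (cases "j \<in> A") (auto intro: trans_less_add1)
qed

text \<open>A support condition bounding all coordinates by any single one makes the inner series finite.\<close>
lemma rsum_eq_box_sum:
  fixes f :: "'n::finite idx \<Rightarrow> complex"
  assumes supp: "\<And>n i j. f n \<noteq> 0 \<Longrightarrow> n j < \<beta> (n i)"
    and "i \<notin> set js" "distinct js" "\<beta> (n i) \<le> B"
  shows "rconv f js n \<and>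
    rsum f js n = (\<Sum>n' | (\<forall>j\<in>set js. n' j < B) \<and> (\<forall>j. j \<notin> set js \<longrightarrow> n' j = n j). f n')"
  using assms(2-)
proof (induction js arbitrary: n)
  case Nil
  have "{n'. \<forall>j. n' j = n j} = {n}" by auto
  then show ?case by simp
next
  case (Cons j js)
  define X where "X = {n'. (\<forall>j'\<in>set (j # js). n' j' < B) \<and> (\<forall>j'. j' \<notin> set (j # js) \<longrightarrow> n' j' = n j')}"
  define Y where "Y = (\<lambda>k. {n'. (\<forall>j'\<in>set js. n' j' < B) \<and> (\<forall>j'. j' \<notin> set js \<longrightarrow> n' j' = (n(j := k)) j')})"
  have IH: "rconv f js (n(j := k)) \<and> rsum f js (n(j := k)) = sum f (Y k)" for k
    unfolding Y_def using Cons.prems by (intro Cons.IH) auto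
  \<comment> \<open>Coordinate \<open>i\<close> is never summed over, so a contributing index has
    \<open>k < \<beta> (n i) \<le> B\<close>.\<close>
  have zero: "rsum f js (n(j := k)) = 0" if "k \<notin> {..<B}" for k
  proof -
    have "sum f (Y k) = 0"
    proof (rule sum.neutral, rule ballI, rule ccontr)
      fix n' assume n': "n' \<in> Y k" "f n' \<noteq> 0"
      have "n' j = k" "n' i = n i" using n'(1) Cons.prems by (auto simp: Y_def)
      then show False using supp[OF n'(2), of j i] Cons.prems that by auto
    qed
    then show ?thesis using IH by simp
  qed
  have "(\<Sum>k. rsum f js (n(j := k))) = (\<Sum>k<B. rsum f js (n(j := k)))"
    by (rule suminf_finite) (auto simp: zero)
  also have "\<dots> = (\<Sum>k<B. sum f (Y k))" using IH by simp
  also have "\<dots> = (\<Sum>k<B. sum f {n'\<in>X. n' j = k})"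
    using Cons.prems by (intro sum.cong refl arg_cong[where f = "sum f"]) (auto simp: X_def Y_def)
  also have "\<dots> = sum f X"
    by (rule sum.group) (use finite_partial_box[of "set (j # js)" B n] in \<open>auto simp: X_def\<close>)
  finally have "rsum f (j # js) n = sum f X" by simp
  moreover have "summable (\<lambda>k. rsum f js (n(j := k)))"
    by (rule summable_finite[of "{..<B}"]) (use zero in auto)
  ultimately show ?case using IH unfolding X_def by simp
qed

text \<open>The first \<open>K\<close> terms of the outermost series add up to a rectangular partial
  sum with side \<open>K\<close> in direction \<open>j\<close> and \<open>2 * K\<close> in the
  others, and all these sides tend to infinity.\<close>

lemma conv_rep_if_conv_rect:
  fixes a :: "'n::finite idx \<Rightarrow> complex"
  assumes supp: "\<And>n i j. a n \<noteq> 0 \<Longrightarrow> n j \<le> 2 * n i"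
    and conv: "conv_rect a g 0"
    and js: "distinct js" "set js = UNIV"
  shows "conv_rep js a g 0"
proof -
  define f where "f = (\<lambda>n. a n * complex_of_real (walsh n g))"
  obtain j js' where js': "js = j # js'" using js(2) by (cases js) auto
  have set': "i \<in> set js' \<longleftrightarrow> i \<noteq> j" for i using js unfolding js' by auto
  have fs: "f n \<noteq> 0 \<Longrightarrow> n j' < Suc (2 * n i)" for n i j'
    using supp[of n j' i] by (auto simp: f_def)
  define z :: "'n idx" where "z = (\<lambda>_. 0)"
  \<comment> \<open>Every \<open>B > 2 * k\<close> gives the same value, so the common bound
    \<open>2 * K\<close> serves all \<open>k < K\<close>.\<close>
  have inner: "rconv f js' (z(j := k)) \<and> rsum f js' (z(j := k)) = (\<Sum>n | (\<forall>i. i \<noteq> j \<longrightarrow> n i < B) \<and> n j = k. f n)"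
    if "2 * k < B" for k B
  proof -
    have "rconv f js' (z(j := k)) \<and> rsum f js' (z(j := k)) =
      (\<Sum>n | (\<forall>i\<in>set js'. n i < B) \<and> (\<forall>i. i \<notin> set js' \<longrightarrow> n i = (z(j := k)) i). f n)"
      by (rule rsum_eq_box_sum[where \<beta> = "\<lambda>x. Suc (2 * x)" and i = j, OF fs]) (use js js' that in auto)
    moreover have "{n. (\<forall>i\<in>set js'. n i < B) \<and> (\<forall>i. i \<notin> set js' \<longrightarrow> n i = (z(j := k)) i)}
        = {n. (\<forall>i. i \<noteq> j \<longrightarrow> n i < B) \<and> n j = k}"
      by (auto simp: set')
    ultimately show ?thesis by simp
  qed
  have part: "(\<Sum>k<K. rsum f js' (z(j := k))) = psum a ((\<lambda>_. 2 * K)(j := K)) g" for K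
  proof -
    define X where "X = {n. \<forall>i. n i < ((\<lambda>_. 2 * K)(j := K)) i}"
    have "(\<Sum>k<K. rsum f js' (z(j := k))) = (\<Sum>k<K. sum f {n\<in>X. n j = k})"
    proof (rule sum.cong[OF refl])
      fix k assume k: "k \<in> {..<K}"
      then have "2 * k < 2 * K" by simp
      from inner[OF this] have "rsum f js' (z(j := k)) = (\<Sum>n | (\<forall>i. i \<noteq> j \<longrightarrow> n i < 2 * K) \<and> n j = k. f n)"
        by blast
      moreover have "{n. (\<forall>i. i \<noteq> j \<longrightarrow> n i < 2 * K) \<and> n j = k} = {n\<in>X. n j = k}"
        using k by (auto simp: X_def)
      ultimately show "rsum f js' (z(j := k)) = sum f {n\<in>X. n j = k}" by simp
    qed
    also have "\<dots> = sum f X"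
      by (rule sum.group) (use finite_box[of "(\<lambda>_. 2 * K)(j := K)"] in \<open>auto simp: X_def dest: spec[of _ j]\<close>)
    finally show ?thesis by (simp add: psum_def X_def f_def)
  qed
  have "(\<lambda>k. rsum f js' (z(j := k))) sums 0"
    unfolding sums_def part LIMSEQ_iff
  proof (intro allI impI)
    fix r :: real assume "0 < r"
    then obtain M where M: "\<And>N. (\<forall>j. M \<le> N j) \<Longrightarrow> norm (psum a N g - 0) < r"
      using conv unfolding conv_rect_def by blast
    show "\<exists>no. \<forall>K\<ge>no. norm (psum a ((\<lambda>_. 2 * K)(j := K)) g - 0) < r"
      by (intro exI[of _ M] allI impI M) auto
  qed
  then have "rconv f js z \<and> rsum f js z = 0"
    unfolding js' using inner by (auto simp: sums_iff)
  then show ?thesis by (simp add: conv_rep_def Let_def f_def z_def)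
qed

text \<open>Within a block any two coordinates differ by a factor below 2.\<close>

lemma acoef_support:
  assumes "acoef n \<noteq> 0"
  shows "n j \<le> 2 * n i"
  using acoef_nonzero[OF assms]
proof
  assume "\<exists>s. n \<in> block (2 * mseq s)"
  then obtain l where "n \<in> block l" by blast
  then have "n j < 2 ^ Suc l" "2 ^ l \<le> n i" by (auto simp: block_def)
  then show ?thesis by simp
qed simp

theorem theorem1:
  assumes "CARD('n::finite) \<ge> 2"
  shows "is_M_set conv_rect (Fset :: 'n pt set)
       \<and> is_M_set conv_cube (Fset :: 'n pt set)
       \<and> (\<forall>js::'n list. distinct js \<and> set js = UNIV \<longrightarrow> is_M_set (conv_rep js) (Fset :: 'n pt set))
       \<and> null_series_for conv_rect (tau_series (tauF (Fset :: 'n pt set))) Fset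
       \<and> null_series_for conv_cube (tau_series (tauF (Fset :: 'n pt set))) Fset
       \<and> (\<forall>js::'n list. distinct js \<and> set js = UNIV \<longrightarrow>
            null_series_for (conv_rep js) (tau_series (tauF (Fset :: 'n pt set))) Fset)"
proof -
  let ?a = "tau_series (tauF (Fset :: 'n pt set))"
  have "?a (\<lambda>_. 0) \<noteq> 0" by (simp add: tau_series_Fset acoef_def)
  then have nz: "\<exists>n. ?a n \<noteq> 0" by blast
  have rect: "null_series_for conv_rect ?a Fset"
    unfolding null_series_for_def using nz conv_rect_tau_series by blast
  moreover have cube: "null_series_for conv_cube ?a Fset"
    unfolding null_series_for_def using nz conv_rect_tau_series conv_cube_if_conv_rect by blast
  moreover have rep: "null_series_for (conv_rep js) ?a Fset"
    if "distinct js \<and> set js = UNIV" for js :: "'n list"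
  proof -
    have "n j \<le> 2 * n i" if "?a n \<noteq> 0" for n i j
      using that by (intro acoef_support) (simp add: tau_series_Fset)
    then have "conv_rep js ?a g 0" if "g \<notin> Fset" for g
      using conv_rep_if_conv_rect[OF _ conv_rect_tau_series[OF that]] \<open>distinct js \<and> set js = UNIV\<close> by blast
    then show ?thesis unfolding null_series_for_def using nz by blast
  qed
  ultimately show ?thesis unfolding is_M_set_def by blast
qed

end
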